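(* Let $d\ge 2$, $\beta\in[0,1]$ and $\kappa>0$, and let $d_1:\mathbb{R}\times\mathbb{R}\to\mathbb{R}_+$ be a pseudo-metric on $\mathbb{R}$. Then $\mathrm{SSFG}(\cdot,\cdot;\beta,\kappa)$ is a pseudo-metric on $\mathcal{P}(\mathbb{R}^d)$: for all $\mu,\nu,\xi\in\mathcal{P}(\mathbb{R}^d)$ we have $\mathrm{SSFG}(\mu,\nu;\beta,\kappa)\ge 0$, $\mathrm{SSFG}(\mu,\nu;\beta,\kappa)=\mathrm{SSFG}(\nu,\mu;\beta,\kappa)$, and there is a constant $C'>0$ (independent of $\mu,\nu,\xi$) with $\mathrm{SSFG}(\mu,\xi;\beta,\kappa)\le C'\big[\mathrm{SSFG}(\mu,\nu;\beta,\kappa)+\mathrm{SSFG}(\nu,\xi;\beta,\kappa)\big]$.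
   Context: $\mathcal{P}(\mathbb{R}^d)$ denotes the probability measures on $\mathbb{R}^d$ with finite moments. A pseudo-metric $d_1$ on $\mathbb{R}$ is a function that is non-negative, symmetric, and satisfies $d_1(x,z)\le C[d_1(x,y)+d_1(y,z)]$ for a universal constant $C>0$ and all $x,y,z$. $\mathbb{S}^{d-1}=\{x\in\mathbb{R}^d:\|x\|=1\}$. For $\theta\in\mathbb{S}^{d-1}$, $\theta\sharp\mu$ is the pushforward of $\mu$ under $x\mapsto\theta^\top x$. For probability measures $\rho,\eta$ on $\mathbb{R}$, $\Pi(\rho,\eta)$ is the set of couplings, and the fused Gromov–Wasserstein discrepancy is $D_{fgw}(\rho,\eta;\beta,d_1)=\min_{\pi\in\Pi(\rho,\eta)}\Big\{(1-\beta)\int d_1(s,t)\,d\pi(s,t)+\beta\iint\big[d_1(s,s')-d_1(t,t')\big]^2\,d\pi(s,t)\,d\pi(s',t')\Big\}$. The von Mises–Fisher distribution $\mathrm{vMF}(\cdot\mid\epsilon,\kappa)$ with location $\epsilon\in\mathbb{S}^{d-1}$ and concentration $\kappa\ge0$ has density $C_d(\kappa)\exp(\kappa\epsilon^\top x)$ with respect to the surface measure on $\mathbb{S}^{d-1}$, where $C_d(\kappa)=\kappa^{d/2-1}/\big((2\pi)^{d/2}I_{d/2-1}(\kappa)\big)$ and $I_v$ is the modified Bessel function of the first kind of order $v$. The spherical sliced fused Gromov–Wasserstein discrepancy is $\mathrm{SSFG}(\mu,\nu;\beta,\kappa)=\max_{\epsilon\in\mathbb{S}^{d-1}}\mathbb{E}_{\theta\sim\mathrm{vMF}(\cdot\mid\epsilon,\kappa)}\big[D_{fgw}(\theta\sharp\mu,\theta\sharp\nu;\beta,d_1)\big]$.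 *)

theory Defs
  imports "HOL-Probability.Probability"
begin

text \<open>Pseudo-metric on the real line in the paper's (quasi-)sense: non-negative,
  symmetric, and satisfying a relaxed triangle inequality with a universal constant.\<close>
definition pseudo_metric :: "(real \<Rightarrow> real \<Rightarrow> real) \<Rightarrow> bool" where
  "pseudo_metric d1 \<longleftrightarrow>
     (\<forall>x y. 0 \<le> d1 x y) \<and> (\<forall>x y. d1 x y = d1 y x) \<and>
     (\<exists>C>0. \<forall>x y z. d1 x z \<le> C * (d1 x y + d1 y z))"

definition prob_fm :: "'a::euclidean_space measure set" where
  "prob_fm = {M. prob_space M \<and> sets M = sets borel \<and>
                 (\<forall>k::nat. (\<integral>\<^sup>+ x. ennreal (norm x ^ k) \<partial>M) < \<infinity>)}"

definition proj_push :: "'a::euclidean_space \<Rightarrow> 'a measure \<Rightarrow> real measure" where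
  "proj_push \<theta> \<mu> = distr \<mu> borel (\<lambda>x. \<theta> \<bullet> x)"

definition couplings :: "real measure \<Rightarrow> real measure \<Rightarrow> (real \<times> real) measure set" where
  "couplings \<rho> \<eta> = {\<pi>. prob_space \<pi> \<and> sets \<pi> = sets (borel :: (real \<times> real) measure) \<and>
                        distr \<pi> borel fst = \<rho> \<and> distr \<pi> borel snd = \<eta>}"

definition fgw_cost :: "real \<Rightarrow> (real \<Rightarrow> real \<Rightarrow> real) \<Rightarrow> (real \<times> real) measure \<Rightarrow> ennreal" where
  "fgw_cost \<beta> d1 \<pi> =
     ennreal (1 - \<beta>) * (\<integral>\<^sup>+ p. ennreal (d1 (fst p) (snd p)) \<partial>\<pi>)
   + ennreal \<beta> * (\<integral>\<^sup>+ p. (\<integral>\<^sup>+ q. ennreal ((d1 (fst p) (fst q) - d1 (snd p) (snd q))\<^sup>2) \<partial>\<pi>) \<partial>\<pi>)"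

definition D_fgw :: "real measure \<Rightarrow> real measure \<Rightarrow> real \<Rightarrow> (real \<Rightarrow> real \<Rightarrow> real) \<Rightarrow> ennreal" where
  "D_fgw \<rho> \<eta> \<beta> d1 = (INF \<pi>\<in>couplings \<rho> \<eta>. fgw_cost \<beta> d1 \<pi>)"

text \<open>Surface (Hausdorff) measure on the unit sphere, via the cone construction:
  sigma(A) = d * Lebesgue({r x : 0 < r < 1, x in A}).\<close>
definition sphere_measure :: "'a::euclidean_space measure" where
  "sphere_measure = scale_measure (of_nat DIM('a))
     (distr (restrict_space lborel (ball 0 1 - {0})) (restrict_space borel (sphere 0 1))
            (\<lambda>x. x /\<^sub>R norm x))"

definition besselI :: "real \<Rightarrow> real \<Rightarrow> real" where
  "besselI v x = (\<Sum>m. (x / 2) powr (2 * real m + v) / (fact m * Gamma (real m + v + 1)))"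

definition vMF_const :: "nat \<Rightarrow> real \<Rightarrow> real" where
  "vMF_const d \<kappa> = \<kappa> powr (real d / 2 - 1) /
                      ((2 * pi) powr (real d / 2) * besselI (real d / 2 - 1) \<kappa>)"

definition vMF :: "'a::euclidean_space \<Rightarrow> real \<Rightarrow> 'a measure" where
  "vMF \<epsilon> \<kappa> = density sphere_measure
                 (\<lambda>x. ennreal (vMF_const DIM('a) \<kappa> * exp (\<kappa> * (\<epsilon> \<bullet> x))))"

definition SSFG :: "'a::euclidean_space measure \<Rightarrow> 'a measure \<Rightarrow> real \<Rightarrow> real
                     \<Rightarrow> (real \<Rightarrow> real \<Rightarrow> real) \<Rightarrow> ennreal" where
  "SSFG \<mu> \<nu> \<beta> \<kappa> d1 =
     (SUP \<epsilon>\<in>sphere 0 1. \<integral>\<^sup>+ \<theta>. D_fgw (proj_push \<theta> \<mu>) (proj_push \<theta> \<nu>) \<beta> d1 \<partial>(vMF \<epsilon> \<kappa>))"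

end

theory Submission
  imports Defs
begin

text \<open>
  Gluing two couplings along their common marginal and using
  \<open>d1 x z \<le> C (d1 x y + d1 y z)\<close> and \<open>(a - c)\<^sup>2 \<le> 2 (a - b)\<^sup>2 + 2 (b - c)\<^sup>2\<close> gives the
  relaxed triangle inequality for the one-dimensional discrepancy with constant \<open>max 2 C\<close>, for
  each direction separately.

  To integrate it over directions, the integral must be additive, although the infimum over couplings
  of a merely Borel cost need not be Borel in the direction (and the integral of a non-measurable
  function is only a lower integral). All probability measures on the plane are laws of a jointly
  measurable sampler driven by a uniform variable and a parameter in the Baire space \<open>nat \<Rightarrow> nat\<close>.
  Hence the strict sublevel sets of the discrepancy are projections along the Baire space of Borel
  sets, that is, analytic sets. Analytic sets are measurable for the completion of every finite
  Borel measure, so the discrepancy agrees almost everywhere with a Borel function.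
\<close>

subsection \<open>Analytic sets\<close>

text \<open>In this form a point of the set comes with a code in
  \<open>nat \<Rightarrow> nat\<close>, and the closure properties below become manipulations of
  codes.\<close>

definition analytic_set :: "'a::topological_space set \<Rightarrow> bool" where
  "analytic_set A \<longleftrightarrow> (\<exists>H :: ('a \<times> (nat \<Rightarrow> nat)) set. closed H \<and> A = fst ` H)"

lemma continuous_on_reindex_snd:
  fixes g :: "'j \<Rightarrow> 'i"
  shows "continuous_on UNIV (\<lambda>p :: 'a::topological_space \<times> ('i \<Rightarrow> 'c::topological_space). \<lambda>k. snd p (g k))"
  by (rule continuous_on_coordinatewise_then_product,
      rule continuous_on_product_then_coordinatewise, rule continuous_on_snd, rule continuous_on_id)

lemma analytic_set_closed: "closed A \<Longrightarrow> analytic_set A"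
  unfolding analytic_set_def by (rule exI[of _ "A \<times> UNIV"]) (auto intro: closed_Times)

text \<open>Entry 0 of a code names an index \<open>n\<close>; the shifted tail is then a code for
  membership in \<open>A n\<close>.\<close>

lemma analytic_set_UN:
  fixes A :: "nat \<Rightarrow> 'a::topological_space set"
  assumes "\<And>n. analytic_set (A n)"
  shows "analytic_set (\<Union>n. A n)"
proof -
  obtain H :: "nat \<Rightarrow> ('a \<times> (nat \<Rightarrow> nat)) set" where H: "\<And>n. closed (H n)" "\<And>n. A n = fst ` H n"
    using assms unfolding analytic_set_def by metis
  \<comment> \<open>Each member of the intersection expresses the implication from
    \<open>snd p 0 = n\<close> to a closed condition. It is a union of two closed sets, because
    \<open>{n}\<close> is open in the discrete topology.\<close>
  define K :: "('a \<times> (nat \<Rightarrow> nat)) set" where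
    "K = (\<Inter>n. {p. snd p 0 \<in> - {n}} \<union> {p. (fst p, \<lambda>k. snd p (Suc k)) \<in> H n})"
  have "closed {p :: 'a \<times> (nat \<Rightarrow> nat). snd p 0 \<in> - {n}}" for n
    using closed_vimage[OF closed_Compl[OF discrete_topology_class.open_discrete[of "{n}"]],
        of "\<lambda>p :: 'a \<times> (nat \<Rightarrow> nat). snd p 0"]
    by (simp add: vimage_def continuous_on_product_then_coordinatewise continuous_on_snd)
  moreover have "closed {p. (fst p, \<lambda>k. snd p (Suc k)) \<in> H n}" for n
    using closed_vimage[OF H(1)[of n], of "\<lambda>p. (fst p, \<lambda>k. snd p (Suc k))"]
    by (simp add: vimage_def continuous_on_Pair continuous_on_fst continuous_on_reindex_snd)
  ultimately have "closed K"
    unfolding K_def by (intro closed_INT ballI closed_Un)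
  moreover have "(\<Union>n. A n) = fst ` K"
  proof (intro set_eqI iffI)
    fix x assume "x \<in> (\<Union>n. A n)"
    then obtain n f where "(x, f) \<in> H n" using H(2) by force
    then have "(x, case_nat n f) \<in> K" by (auto simp: K_def)
    then show "x \<in> fst ` K" by force
  next
    fix x assume "x \<in> fst ` K"
    then obtain f where "(x, f) \<in> K" by force
    then have "(x, \<lambda>k. f (Suc k)) \<in> H (f 0)" by (auto simp: K_def)
    then show "x \<in> (\<Union>n. A n)" using H(2) by force
  qed
  ultimately show ?thesis unfolding analytic_set_def by blast
qed

text \<open>One code stores witnesses for all \<open>n\<close> at once: row \<open>n\<close> under
  \<open>prod_encode\<close> is a code for membership in \<open>A n\<close>.\<close>

lemma analytic_set_INT:
  fixes A :: "nat \<Rightarrow> 'a::topological_space set"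
  assumes "\<And>n. analytic_set (A n)"
  shows "analytic_set (\<Inter>n. A n)"
proof -
  obtain H :: "nat \<Rightarrow> ('a \<times> (nat \<Rightarrow> nat)) set" where H: "\<And>n. closed (H n)" "\<And>n. A n = fst ` H n"
    using assms unfolding analytic_set_def by metis
  define K :: "('a \<times> (nat \<Rightarrow> nat)) set" where
    "K = (\<Inter>n. {p. (fst p, \<lambda>k. snd p (prod_encode (n, k))) \<in> H n})"
  have "closed {p. (fst p, \<lambda>k. snd p (prod_encode (n, k))) \<in> H n}" for n
    using closed_vimage[OF H(1)[of n], of "\<lambda>p. (fst p, \<lambda>k. snd p (prod_encode (n, k)))"]
    by (simp add: vimage_def continuous_on_Pair continuous_on_fst continuous_on_reindex_snd)
  then have "closed K"
    unfolding K_def by (intro closed_INT ballI)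
  moreover have "(\<Inter>n. A n) = fst ` K"
  proof (intro set_eqI iffI)
    fix x assume "x \<in> (\<Inter>n. A n)"
    then have "\<exists>f. (x, f) \<in> H n" for n using H(2) by force
    then obtain f where "\<And>n. (x, f n) \<in> H n" by metis
    then have "(x, \<lambda>m. f (fst (prod_decode m)) (snd (prod_decode m))) \<in> K" by (auto simp: K_def)
    then show "x \<in> fst ` K" by force
  next
    fix x assume "x \<in> fst ` K"
    then obtain f where "(x, f) \<in> K" by force
    then show "x \<in> (\<Inter>n. A n)" using H(2) by (force simp: K_def)
  qed
  ultimately show ?thesis unfolding analytic_set_def by blast
qed

lemma analytic_set_open:
  fixes A :: "'a::topological_space set"
  assumes "metrizable_space (euclidean :: 'a topology)" "open A"
  shows "analytic_set A"
proof -
  have "fsigma_in euclidean A"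
    using assms by (intro open_imp_fsigma_in) simp_all
  then obtain C where "\<And>n::nat. closed (C n)" "(\<Union>n. C n) = A"
    unfolding fsigma_in_ascending by auto
  then show ?thesis
    using analytic_set_UN[of C] analytic_set_closed by blast
qed

text \<open>Complements of analytic sets need not be analytic, so the induction carries
  \<open>A\<close> and \<open>- A\<close> together; complementation merely swaps the two
  claims.\<close>

lemma analytic_set_borel:
  fixes A :: "'a::topological_space set"
  assumes "metrizable_space (euclidean :: 'a topology)" "A \<in> sets borel"
  shows "analytic_set A"
proof -
  from assms(2) have "A \<in> sigma_sets UNIV {S. open S}"
    by (simp add: sets_borel)
  then have "analytic_set A \<and> analytic_set (- A)"
  proof induction
    case (Basic a)
    then show ?case using assms(1) by (auto intro: analytic_set_open analytic_set_closed)
  next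
    case Empty
    then show ?case by (auto intro: analytic_set_closed)
  next
    case (Compl a)
    then show ?case by (simp add: Compl_eq_Diff_UNIV double_diff)
  next
    case (Union a)
    then show ?case by (auto simp: intro!: analytic_set_UN analytic_set_INT)
  qed
  then show ?thesis ..
qed

text \<open>Provides what the passage from Borel to analytic sets requires of the product from which
  sets will be projected.\<close>

lemma metrizable_space_prod_baire:
  "metrizable_space (euclidean :: ('a::metric_space \<times> (nat \<Rightarrow> nat)) topology)"
proof -
  have "discrete_topology UNIV = (euclidean :: nat topology)"
    unfolding discrete_topology_unique by (simp add: discrete_topology_class.open_discrete)
  then have "metrizable_space (euclidean :: nat topology)"
    by (metis metrizable_space_discrete_topology)
  then have "metrizable_space (product_topology (\<lambda>_ :: nat. euclidean :: nat topology) UNIV)"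
    by (simp add: metrizable_space_product_topology)
  then have "metrizable_space (prod_topology (euclidean :: 'a topology) (euclidean :: (nat \<Rightarrow> nat) topology))"
    by (simp add: metrizable_space_prod_topology metrizable_space_euclidean euclidean_product_topology del: prod_topology_euclidean)
  then show ?thesis by simp
qed

text \<open>Two sequences are interleaved into one code: the even entries hold the coordinate
  projected away, the odd entries the code witnessing membership in \<open>B\<close>.\<close>

lemma analytic_set_fst_image:
  fixes B :: "('a::topological_space \<times> (nat \<Rightarrow> nat)) set"
  assumes "analytic_set B"
  shows "analytic_set (fst ` B)"
proof -
  obtain H :: "(('a \<times> (nat \<Rightarrow> nat)) \<times> (nat \<Rightarrow> nat)) set" where H: "closed H" "B = fst ` H"
    using assms unfolding analytic_set_def by blast
  define K :: "('a \<times> (nat \<Rightarrow> nat)) set" where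
    "K = {p. ((fst p, \<lambda>k. snd p (2 * k)), \<lambda>k. snd p (2 * k + 1)) \<in> H}"
  have "closed K"
    using closed_vimage[OF H(1), of "\<lambda>p. ((fst p, \<lambda>k. snd p (2 * k)), \<lambda>k. snd p (2 * k + 1))"]
    by (simp add: vimage_def K_def continuous_on_Pair continuous_on_fst continuous_on_reindex_snd)
  moreover have "fst ` B = fst ` K"
  proof (intro set_eqI iffI)
    fix x assume "x \<in> fst ` B"
    then obtain f g where "((x, f), g) \<in> H" using H(2) by force
    then have "(x, \<lambda>k. if even k then f (k div 2) else g (k div 2)) \<in> K" by (simp add: K_def)
    then show "x \<in> fst ` K" by force
  next
    fix x assume "x \<in> fst ` K"
    then show "x \<in> fst ` B" using H(2) by (force simp: K_def)
  qed
  ultimately show ?thesis unfolding analytic_set_def by blast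
qed

section \<open>Measurability of analytic sets for the completion of a finite Borel measure\<close>

lemma tendsto_componentwise:
  fixes f :: "'b \<Rightarrow> 'i \<Rightarrow> 'c::topological_space"
  assumes "\<And>i. ((\<lambda>x. f x i) \<longlongrightarrow> l i) F"
  shows "(f \<longlongrightarrow> l) F"
proof -
  have "limitin (product_topology (\<lambda>_. euclidean) UNIV) f l F"
    using assms by (auto simp: limitin_componentwise)
  then show ?thesis by (simp add: euclidean_product_topology)
qed

text \<open>Choquet's capacity argument: bounding the coordinates of the Baire space one after the other by
  \<open>m 0, m 1, \<dots>\<close> loses arbitrarily little outer measure, and compactness of
  \<open>\<Pi>i. {..m i}\<close> makes the intersection of the closures of the resulting projections a subset of
  the original projection.\<close>
lemma closed_inner_approx_fst_image:
  fixes H :: "('a::metric_space \<times> (nat \<Rightarrow> nat)) set"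
  assumes M: "finite_measure M" "sets M = sets borel"
    and H: "closed H" and c: "c < outer_measure_of M (fst ` H)"
  shows "\<exists>L\<in>sets M. L \<subseteq> fst ` H \<and> c \<le> emeasure M L"
proof -
  interpret finite_measure M by fact
  have sp: "space M = UNIV" using sets_eq_imp_space_eq[OF M(2)] by simp
  let ?o = "\<lambda>S. outer_measure_of M (fst ` S)"
  have "\<exists>S. \<forall>n. (c < ?o (S n) \<and> (n = 0 \<longrightarrow> S n = H)) \<and> (\<exists>m. S (Suc n) = S n \<inter> {p. snd p n \<le> m})"
  proof (rule dependent_nat_choice)
    show "\<exists>x. c < ?o x \<and> (0 = (0::nat) \<longrightarrow> x = H)" using c by blast
    fix S and n :: nat assume S: "c < ?o S \<and> (n = 0 \<longrightarrow> S = H)"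
    \<comment> \<open>Outer measure is continuous along increasing sequences of arbitrary sets, so
      some bound on coordinate \<open>n\<close> keeps it above \<open>c\<close>.\<close>
    have "(SUP m. ?o (S \<inter> {p. snd p n \<le> m})) = outer_measure_of M (\<Union>m. fst ` (S \<inter> {p. snd p n \<le> m}))"
      by (rule SUP_outer_measure_of_incseq) (auto simp: sp incseq_def)
    also have "(\<Union>m. fst ` (S \<inter> {p. snd p n \<le> m})) = fst ` S" by force
    finally have "c < (SUP m. ?o (S \<inter> {p. snd p n \<le> m}))" using S by simp
    then obtain m where "c < ?o (S \<inter> {p. snd p n \<le> m})" by (auto simp: less_SUP_iff)
    then show "\<exists>y. (c < ?o y \<and> (Suc n = 0 \<longrightarrow> y = H)) \<and> (\<exists>m. y = S \<inter> {p. snd p n \<le> m})"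
      by blast
  qed
  then obtain S where S0: "\<And>n. c < ?o (S n)" "S 0 = H"
    and "\<And>n. \<exists>m. S (Suc n) = S n \<inter> {p. snd p n \<le> m}"
    by blast
  then obtain m where "\<And>n. S (Suc n) = S n \<inter> {p. snd p n \<le> m n}"
    by metis
  note S = S0 this
  have dec: "decseq S" using S(3) by (auto intro!: decseq_SucI)
  have SH: "S n \<subseteq> H" for n using decseqD[OF dec, of 0 n] S(2) by auto
  have Sm: "snd p i \<le> m i" if "p \<in> S n" "i < n" for p i n
    using decseqD[OF dec, of "Suc i" n] S(3)[of i] that by auto
  \<comment> \<open>The projections of the sets \<open>S n\<close> need not be measurable. Their
    closures are, and their measure is at least as large as the outer measure of the
    projections.\<close>
  define K where "K n = closure (fst ` S n)" for n
  define L where "L = (\<Inter>n. K n)"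
  have K: "K n \<in> sets M" for n by (simp add: K_def M)
  have "c \<le> emeasure M (K n)" for n
    using S(1)[of n] outer_measure_of_mono[of "fst ` S n" "K n" M] K[of n]
    by (simp add: K_def closure_subset)
  moreover have "(INF n. emeasure M (K n)) = emeasure M L"
    unfolding L_def
    by (rule INF_emeasure_decseq)
      (use K dec in \<open>auto simp: K_def decseq_def intro!: closure_mono image_mono\<close>)
  ultimately have "c \<le> emeasure M L" by (metis INF_greatest)
  moreover have "L \<in> sets M" using K by (auto simp: L_def)
  moreover have "L \<subseteq> fst ` H"
  proof
    fix x assume "x \<in> L"
    then have "\<exists>p\<in>S n. dist (fst p) x < 1 / real (Suc n)" for n
      using closure_approachableD[of x "fst ` S n" "1 / real (Suc n)"]
      by (auto simp: L_def K_def dist_commute)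
    then obtain p where p: "\<And>n. p n \<in> S n" "\<And>n. dist (fst (p n)) x < 1 / real (Suc n)"
      by metis
    have px: "(\<lambda>n. fst (p n)) \<longlonglongrightarrow> x"
    proof (rule metric_LIMSEQ_I)
      fix r :: real assume "0 < r"
      then obtain N where "1 / real (Suc N) < r" using nat_approx_posE by blast
      then have "dist (fst (p n)) x < r" if "N \<le> n" for n
        using p(2)[of n] that frac_le[of 1 1 "real (Suc N)" "real (Suc n)"] by simp
      then show "\<exists>N. \<forall>n\<ge>N. dist (fst (p n)) x < r" by blast
    qed
    have "compactin (product_topology (\<lambda>_. euclidean) UNIV) (PiE UNIV (\<lambda>i. {..m i}))"
      by (auto simp: compactin_PiE intro: finite_imp_compact)
    then have "compact (PiE UNIV (\<lambda>i. {..m i}))"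
      by (simp add: euclidean_product_topology)
    then have sc: "seq_compact (PiE UNIV (\<lambda>i. {..m i}))" by (rule compact_imp_seq_compact)
    \<comment> \<open>The point \<open>p n\<close> is bounded only in its first \<open>n\<close>
      coordinates. Truncation by \<open>m\<close> moves it into the compact product, and at a fixed
      coordinate \<open>i\<close> it changes nothing once \<open>n\<close> exceeds \<open>i\<close>;
      so the limit of the truncated points is also the limit of the original ones.\<close>
    have "\<forall>n. (\<lambda>i. min (snd (p n) i) (m i)) \<in> PiE UNIV (\<lambda>i. {..m i})" by auto
    from seq_compactE[OF sc this] obtain f r where r: "strict_mono (r :: nat \<Rightarrow> nat)"
      and f: "((\<lambda>n i. min (snd (p n) i) (m i)) \<circ> r) \<longlonglongrightarrow> f"
      by metis
    have "(\<lambda>k. snd (p (r k)) i) \<longlonglongrightarrow> f i" for i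
    proof (rule Lim_transform_eventually)
      show "(\<lambda>k. min (snd (p (r k)) i) (m i)) \<longlonglongrightarrow> f i"
        using continuous_on_tendsto_compose[OF continuous_on_product_coordinates[of i] f]
        by (simp add: o_def)
      show "\<forall>\<^sub>F k in sequentially. min (snd (p (r k)) i) (m i) = snd (p (r k)) i"
        using eventually_gt_at_top[of i]
      proof eventually_elim
        case (elim k)
        then show ?case using Sm[OF p(1)[of "r k"], of i] seq_suble[OF r, of k] by simp
      qed
    qed
    then have "(\<lambda>k. snd (p (r k))) \<longlonglongrightarrow> f" by (rule tendsto_componentwise)
    moreover have "(\<lambda>k. fst (p (r k))) \<longlonglongrightarrow> x"
      using LIMSEQ_subseq_LIMSEQ[OF px r] by (simp add: o_def)
    ultimately have "(\<lambda>k. (fst (p (r k)), snd (p (r k)))) \<longlonglongrightarrow> (x, f)"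
      by (intro tendsto_Pair)
    moreover have "p (r k) \<in> H" for k using p(1) SH by blast
    ultimately have "(x, f) \<in> H"
      using closed_sequentially[OF H, of "\<lambda>k. p (r k)" "(x, f)"] by simp
    then show "x \<in> fst ` H" by force
  qed
  ultimately show ?thesis by blast
qed

text \<open>A Borel hull from outside and a countable union of Borel sets from inside have the same
  finite measure, which squeezes the set into the completion.\<close>

lemma analytic_set_completion:
  fixes A :: "'a::metric_space set"
  assumes M: "finite_measure M" "sets M = sets borel" and A: "analytic_set A"
  shows "A \<in> sets (completion M)"
proof -
  interpret finite_measure M by fact
  have sp: "space M = UNIV" using sets_eq_imp_space_eq[OF M(2)] by simp
  obtain E where E: "E \<in> sets M" "A \<subseteq> E" "outer_measure_of M A = emeasure M E"
    using outer_measure_of_attain[of A M] sp by auto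
  \<comment> \<open>A null hull is treated separately, since a sequence strictly below the measure
    of the hull requires that measure to be positive.\<close>
  have "\<exists>L\<in>sets M. L \<subseteq> A \<and> emeasure M E = emeasure M L"
  proof (cases "emeasure M E = 0")
    case True
    then show ?thesis by (intro bexI[of _ "{}"]) auto
  next
    case False
    then have "0 < emeasure M E" by (simp add: zero_less_iff_neq_zero)
    then obtain c :: "nat \<Rightarrow> ennreal" where c: "\<And>n. c n < emeasure M E" "c \<longlonglongrightarrow> emeasure M E"
      using approx_from_below_dense_linorder by blast
    have "\<exists>L\<in>sets M. L \<subseteq> A \<and> c n \<le> emeasure M L" for n
      using closed_inner_approx_fst_image[OF M, of _ "c n"] A c(1)[of n] E(3)
      unfolding analytic_set_def by auto
    then obtain L where L: "\<And>n. L n \<in> sets M" "\<And>n. L n \<subseteq> A" "\<And>n. c n \<le> emeasure M (L n)"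
      by metis
    have UL: "(\<Union>n. L n) \<in> sets M" using L(1) by auto
    have "c n \<le> emeasure M (\<Union>n. L n)" for n
      using L(3)[of n] emeasure_mono[of "L n" "\<Union>n. L n" M] UL by (meson UN_upper UNIV_I order_trans)
    then have "emeasure M E \<le> emeasure M (\<Union>n. L n)"
      using c(2) by (intro LIMSEQ_le_const2) auto
    moreover have "emeasure M (\<Union>n. L n) \<le> emeasure M E"
      using L(2) E by (intro emeasure_mono) auto
    ultimately show ?thesis using UL L(2) by (intro bexI[of _ "\<Union>n. L n"]) auto
  qed
  then obtain L where L: "L \<in> sets M" "L \<subseteq> A" "emeasure M E = emeasure M L" by blast
  show ?thesis
    by (rule completion.complete_sets_sandwich[where A = L and C = E])
      (use L E in \<open>auto simp: less_top[symmetric] emeasure_finite\<close>)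
qed

text \<open>Strict sublevel sets are the right test for an infimum: it lies below \<open>c\<close>
  exactly when some competitor does, and an existential statement is a projection.\<close>

lemma analytic_less_AE_borel:
  fixes g :: "'a::metric_space \<Rightarrow> ennreal"
  assumes M: "finite_measure M" "sets M = sets borel" and g: "\<And>c. analytic_set {x. g x < c}"
  shows "\<exists>h\<in>borel_measurable borel. AE x in M. g x = h x"
proof -
  have "space M = UNIV" using sets_eq_imp_space_eq[OF M(2)] by simp
  then have "g \<in> borel_measurable (completion M)"
    using analytic_set_completion[OF M g] by (intro borel_measurableI_less) auto
  then show ?thesis
    using completion_ex_borel_measurable[of g M] measurable_cong_sets[OF M(2) refl] by auto
qed

subsection \<open>Noise outsourcing\<close>

text \<open>On the set \<open>D\<close> where the inequality fails, \<open>f - g\<close> is positive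
  but has integral zero by the hypothesis, so \<open>D\<close> is null. Finiteness of the integral
  of \<open>f\<close> justifies the subtraction.\<close>

lemma AE_le_of_set_nn_integral_le:
  fixes f g :: "'a \<Rightarrow> ennreal"
  assumes [measurable]: "f \<in> borel_measurable M" "g \<in> borel_measurable M"
    and fin: "(\<integral>\<^sup>+x. f x \<partial>M) < \<infinity>"
    and le: "\<And>A. A \<in> sets M \<Longrightarrow> (\<integral>\<^sup>+x. f x * indicator A x \<partial>M) \<le> (\<integral>\<^sup>+x. g x * indicator A x \<partial>M)"
  shows "AE x in M. f x \<le> g x"
proof -
  define D where "D = {x\<in>space M. g x < f x}"
  have [measurable]: "D \<in> sets M" unfolding D_def by measurable
  have gf: "g x * indicator D x \<le> f x * indicator D x" for x
    by (auto simp: D_def indicator_def)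
  have "(\<integral>\<^sup>+x. f x * indicator D x \<partial>M) \<le> (\<integral>\<^sup>+x. f x \<partial>M)"
    by (intro nn_integral_mono) (auto simp: indicator_def)
  with fin have f_fin: "(\<integral>\<^sup>+x. f x * indicator D x \<partial>M) < \<infinity>" by auto
  moreover have "(\<integral>\<^sup>+x. g x * indicator D x \<partial>M) \<le> (\<integral>\<^sup>+x. f x * indicator D x \<partial>M)"
    using gf by (rule nn_integral_mono)
  ultimately have "(\<integral>\<^sup>+x. g x * indicator D x \<partial>M) \<noteq> \<infinity>" by auto
  then have "(\<integral>\<^sup>+x. f x * indicator D x - g x * indicator D x \<partial>M)
      = (\<integral>\<^sup>+x. f x * indicator D x \<partial>M) - (\<integral>\<^sup>+x. g x * indicator D x \<partial>M)"
    using gf by (intro nn_integral_diff) auto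
  also have "\<dots> = 0" using le[of D] f_fin by (simp add: diff_eq_0_iff_ennreal)
  finally have "AE x in M. f x * indicator D x - g x * indicator D x = 0"
    by (subst (asm) nn_integral_0_iff_AE) auto
  with AE_space show ?thesis
  proof eventually_elim
    case (elim x)
    show ?case
    proof (rule ccontr)
      assume "\<not> f x \<le> g x"
      with elim show False by (auto simp: D_def diff_eq_0_iff_ennreal)
    qed
  qed
qed

text \<open>For fixed \<open>A\<close> the values on half-lines determine the values on all
  \<open>A \<times> B\<close>, and rectangles form an intersection-stable generator.\<close>

lemma measure_eqI_pair_greaterThan:
  fixes P P' :: "('a \<times> real) measure"
  assumes P: "finite_measure P" "sets P = sets (N \<Otimes>\<^sub>M borel)" and P': "sets P' = sets (N \<Otimes>\<^sub>M borel)"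
    and eq: "\<And>A x. A \<in> sets N \<Longrightarrow> emeasure P (A \<times> {x<..}) = emeasure P' (A \<times> {x<..})"
  shows "P = P'"
proof -
  interpret finite_measure P by fact
  note [measurable_cong] = P(2) P'
  \<comment> \<open>Restricting to \<open>A \<times> UNIV\<close> and projecting turns the map from
    \<open>B\<close> to the mass of \<open>A \<times> B\<close> into a measure on the line, to which
    one-dimensional uniqueness applies.\<close>
  have cyl: "emeasure (distr (density L (indicator (A \<times> UNIV))) borel snd) B = emeasure L (A \<times> B)"
    if [measurable]: "A \<in> sets N" "B \<in> sets borel" and L[measurable_cong]: "sets L = sets (N \<Otimes>\<^sub>M borel)"
    for A B and L :: "('a \<times> real) measure"
  proof -
    have sp: "space L = space N \<times> UNIV"
      using sets_eq_imp_space_eq[OF L] by (simp add: space_pair_measure)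
    have "emeasure (distr (density L (indicator (A \<times> UNIV))) borel snd) B
        = (\<integral>\<^sup>+p. indicator (A \<times> UNIV) p * indicator (snd -` B \<inter> space L) p \<partial>L)"
      by (subst emeasure_distr) (auto simp: emeasure_density)
    also have "\<dots> = (\<integral>\<^sup>+p. indicator (A \<times> B) p \<partial>L)"
      by (intro nn_integral_cong) (auto simp: indicator_def)
    finally show ?thesis by simp
  qed
  have rect: "emeasure P (A \<times> B) = emeasure P' (A \<times> B)" if A: "A \<in> sets N" and B: "B \<in> sets borel" for A B
  proof -
    have "distr (density P (indicator (A \<times> UNIV))) borel snd = distr (density P' (indicator (A \<times> UNIV))) borel snd"
    proof (rule measure_eqI_lessThan)
      fix x :: real
      show "emeasure (distr (density P (indicator (A \<times> UNIV))) borel snd) {x<..} < \<infinity>"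
        using A by (subst cyl) (auto simp: P less_top[symmetric] emeasure_finite)
      show "emeasure (distr (density P (indicator (A \<times> UNIV))) borel snd) {x<..}
          = emeasure (distr (density P' (indicator (A \<times> UNIV))) borel snd) {x<..}"
        using A by (simp add: cyl P P' eq)
    qed auto
    then show ?thesis using cyl[OF A B P(2)] cyl[OF A B P'] by simp
  qed
  show ?thesis
  proof (rule measure_eqI_generator_eq[OF Int_stable_pair_measure_generator[of N borel], where A = "\<lambda>_. space N \<times> UNIV"])
    show "{a \<times> b |a b. a \<in> sets N \<and> b \<in> sets (borel :: real measure)} \<subseteq> Pow (space N \<times> UNIV)"
      using sets.sets_into_space by fastforce
    show "sets P = sigma_sets (space N \<times> UNIV) {a \<times> b |a b. a \<in> sets N \<and> b \<in> sets borel}"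
      "sets P' = sigma_sets (space N \<times> UNIV) {a \<times> b |a b. a \<in> sets N \<and> b \<in> sets borel}"
      using P(2) P' by (simp_all add: sets_pair_measure)
    show "range (\<lambda>_::nat. space N \<times> UNIV) \<subseteq> {a \<times> b |a b. a \<in> sets N \<and> b \<in> sets (borel :: real measure)}"
    proof -
      have "space N \<in> sets N \<and> (UNIV :: real set) \<in> sets borel" by simp
      then show ?thesis by fast
    qed
    show "emeasure P (space N \<times> UNIV) \<noteq> \<infinity>" by simp
  qed (use rect in auto)
qed

section \<open>Uniform noise and rational thresholds\<close>

definition unit_uniform :: "real measure" where
  "unit_uniform = uniform_measure lborel {0<..<1}"

lemma sets_unit_uniform [simp, measurable_cong]: "sets unit_uniform = sets borel"
  by (simp add: unit_uniform_def)

lemma space_unit_uniform [simp]: "space unit_uniform = UNIV"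
  by (simp add: unit_uniform_def)

lemma prob_space_unit_uniform: "prob_space unit_uniform"
  unfolding unit_uniform_def by (rule prob_space_uniform_measure) auto

lemma emeasure_unit_uniform_lessThan:
  assumes "0 \<le> z" "z \<le> 1"
  shows "emeasure unit_uniform {..<z} = ennreal z"
proof -
  have "{0<..<1} \<inter> {..<z} = {0<..<z}" using assms by auto
  then show ?thesis using assms by (simp add: unit_uniform_def divide_ennreal_def)
qed

text \<open>Countably many thresholds suffice for tails and Dedekind cuts, and they allow
  exceptional null sets to be merged into one.\<close>

definition rat_enum :: "nat \<Rightarrow> real" where
  "rat_enum n = of_rat (from_nat n)"

lemma rat_enum_between:
  assumes "x < y"
  obtains n where "x < rat_enum n" "rat_enum n < y"
proof -
  obtain r where "x < of_rat r" "of_rat r < y" using of_rat_dense[OF assms] by blast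
  then show thesis using that[of "to_nat r"] by (simp add: rat_enum_def)
qed

lemma rat_enum_decreasing:
  obtains r where "\<And>k. x < rat_enum (r k)" "\<And>k. rat_enum (r (Suc k)) \<le> rat_enum (r k)"
    "\<And>y. x < y \<Longrightarrow> \<exists>k. rat_enum (r k) < y"
proof -
  \<comment> \<open>The rationals come from consecutive disjoint intervals shrinking to
    \<open>x\<close>, which makes them decrease.\<close>
  have "\<exists>n. x + 1 / real (Suc (Suc k)) < rat_enum n \<and> rat_enum n < x + 1 / real (Suc k)" for k
    by (rule rat_enum_between[of "x + 1 / real (Suc (Suc k))" "x + 1 / real (Suc k)"])
      (auto simp: field_simps)
  then obtain r where r: "\<And>k. x + 1 / real (Suc (Suc k)) < rat_enum (r k)" "\<And>k. rat_enum (r k) < x + 1 / real (Suc k)"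
    by metis
  have r_gt: "x < rat_enum (r k)" for k
  proof -
    have "0 < 1 / real (Suc (Suc k))" by simp
    then show ?thesis using r(1)[of k] by linarith
  qed
  have r_dec: "rat_enum (r (Suc k)) \<le> rat_enum (r k)" for k
    using r(1)[of k] r(2)[of "Suc k"] by linarith
  have r_lim: "\<exists>k. rat_enum (r k) < y" if xy: "x < y" for y
  proof -
    obtain k where "1 / real (Suc k) < y - x" using nat_approx_posE[of "y - x"] xy by (metis diff_gt_0_iff_gt)
    then show ?thesis using r(2)[of k] by (intro exI[of _ k]) linarith
  qed
  show thesis by (rule that[OF r_gt r_dec r_lim])
qed

text \<open>If \<open>z n\<close> is the probability that a random variable exceeds \<open>rat_enum n\<close>, then
  \<open>tail_quantile z\<close> applied to a uniform variable has the same law. With values of \<open>z\<close> in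
  \<open>{0, 1}\<close> and \<open>w = 0\<close> it reads off a real number from its lower Dedekind cut. No monotonicity of
  \<open>z\<close> is imposed, so that \<open>z\<close> may range over all sequences; infinite values are possible.\<close>
definition tail_quantile :: "(nat \<Rightarrow> real) \<Rightarrow> real \<Rightarrow> ereal" where
  "tail_quantile z w = (SUP n. if w < z n then ereal (rat_enum n) else - \<infinity>)"

lemma less_tail_quantile_iff:
  "ereal x < tail_quantile z w \<longleftrightarrow> (\<exists>n. x < rat_enum n \<and> w < z n)"
  unfolding tail_quantile_def less_SUP_iff by (auto split: if_splits)

lemma measurable_tail_quantile [measurable (raw)]:
  assumes [measurable]: "\<And>n. (\<lambda>p. z p n) \<in> borel_measurable M" "w \<in> borel_measurable M"
  shows "(\<lambda>p. tail_quantile (z p) (w p)) \<in> borel_measurable M"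
  unfolding tail_quantile_def by measurable

text \<open>The functions \<open>f n\<close> are the conditional tail probabilities at \<open>rat_enum n\<close> given the first
  coordinate, obtained from the Radon--Nikodym theorem.\<close>
lemma noise_outsourcing:
  fixes P :: "('a \<times> real) measure"
  assumes P: "prob_space P" "sets P = sets (N \<Otimes>\<^sub>M borel)"
  obtains f where "\<And>n. f n \<in> borel_measurable N"
    and "P = distr (distr P N fst \<Otimes>\<^sub>M unit_uniform) (N \<Otimes>\<^sub>M borel)
               (\<lambda>p. (fst p, real_of_ereal (tail_quantile (\<lambda>n. f n (fst p)) (snd p))))"
proof -
  interpret P: prob_space P by fact
  interpret U: prob_space unit_uniform by (rule prob_space_unit_uniform)
  note [measurable_cong] = P(2)
  have spP: "space P = space N \<times> UNIV"
    using sets_eq_imp_space_eq[OF P(2)] by (simp add: space_pair_measure)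
  define \<rho> where "\<rho> = distr P N fst"
  have sets_\<rho>[simp, measurable_cong]: "sets \<rho> = sets N" by (simp add: \<rho>_def)
  have space_\<rho>[simp]: "space \<rho> = space N" by (simp add: \<rho>_def)
  interpret \<rho>: prob_space \<rho> unfolding \<rho>_def by (rule P.prob_space_distr) simp
  interpret \<rho>U: pair_prob_space \<rho> unit_uniform ..
  have \<rho>: "emeasure \<rho> A = emeasure P (A \<times> UNIV)" if "A \<in> sets N" for A
    using that sets.sets_into_space[OF that] unfolding \<rho>_def
    by (subst emeasure_distr) (auto simp: spP intro!: arg_cong[where f = "emeasure P"])
  have "\<exists>g\<in>borel_measurable N. \<forall>A\<in>sets N. (\<integral>\<^sup>+t. g t * indicator A t \<partial>\<rho>) = emeasure P (A \<times> {rat_enum n<..})" for n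
  proof -
    \<comment> \<open>The part of the first marginal where the second coordinate exceeds
      \<open>rat_enum n\<close>; its density with respect to the whole marginal is the conditional
      tail probability.\<close>
    define D where "D = distr (density P (indicator (space N \<times> {rat_enum n<..}))) N fst"
    have D: "emeasure D A = emeasure P (A \<times> {rat_enum n<..})" if [measurable]: "A \<in> sets N" for A
    proof -
      have "emeasure D A = (\<integral>\<^sup>+p. indicator (space N \<times> {rat_enum n<..}) p * indicator (fst -` A \<inter> space P) p \<partial>P)"
        unfolding D_def by (subst emeasure_distr) (auto simp: emeasure_density)
      also have "\<dots> = (\<integral>\<^sup>+p. indicator (A \<times> {rat_enum n<..}) p \<partial>P)"
        by (intro nn_integral_cong) (auto simp: indicator_def spP)
      finally show ?thesis by simp
    qed
    have "absolutely_continuous \<rho> D"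
    proof -
      have "emeasure P (A \<times> {rat_enum n<..}) = 0" if "A \<in> sets N" "emeasure P (A \<times> UNIV) = 0" for A
        using emeasure_mono[of "A \<times> {rat_enum n<..}" "A \<times> UNIV" P] that by (auto simp: P)
      then show ?thesis
        unfolding absolutely_continuous_def by (auto simp: null_sets_def \<rho> D) (auto simp: D_def)
    qed
    moreover have sD: "sets D = sets \<rho>" by (simp add: D_def)
    ultimately obtain g where g: "g \<in> borel_measurable \<rho>" "density \<rho> g = D"
      using \<rho>.Radon_Nikodym by blast
    then have "(\<integral>\<^sup>+t. g t * indicator A t \<partial>\<rho>) = emeasure P (A \<times> {rat_enum n<..})" if "A \<in> sets N" for A
      using D[OF that] that by (simp add: emeasure_density flip: g(2))
    moreover have "g \<in> borel_measurable N" using g(1) by simp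
    ultimately show ?thesis by blast
  qed
  then obtain g where g_meas [measurable]: "\<And>n. g n \<in> borel_measurable N"
    and g: "\<And>n A. A \<in> sets N \<Longrightarrow> (\<integral>\<^sup>+t. g n t * indicator A t \<partial>\<rho>) = emeasure P (A \<times> {rat_enum n<..})"
    by metis
  have g_fin: "(\<integral>\<^sup>+t. g n t \<partial>\<rho>) < \<infinity>" for n
  proof -
    have "(\<integral>\<^sup>+t. g n t \<partial>\<rho>) = (\<integral>\<^sup>+t. g n t * indicator (space N) t \<partial>\<rho>)"
      by (intro nn_integral_cong) auto
    then show ?thesis by (simp add: g less_top[symmetric])
  qed
  \<comment> \<open>Bound and monotonicity hold after integration over every set, hence almost
    everywhere for each choice of indices; as these are countable, one null set covers all
    exceptions.\<close>
  have "AE t in \<rho>. g n t \<le> 1" for n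
    using g_fin[of n]
    by (intro AE_le_of_set_nn_integral_le) (auto simp: g \<rho> P intro!: emeasure_mono)
  moreover have "AE t in \<rho>. g m t \<le> g n t" if "rat_enum n \<le> rat_enum m" for m n
    using g_fin[of m] that
    by (intro AE_le_of_set_nn_integral_le) (auto simp: g P intro!: emeasure_mono)
  ultimately have AE_good: "AE t in \<rho>. (\<forall>n. g n t \<le> 1) \<and> (\<forall>m n. rat_enum n \<le> rat_enum m \<longrightarrow> g m t \<le> g n t)"
    by (simp add: AE_all_countable)
  define G where "G = {t\<in>space N. (\<forall>n. g n t \<le> 1) \<and> (\<forall>m n. rat_enum n \<le> rat_enum m \<longrightarrow> g m t \<le> g n t)}"
  have [measurable]: "G \<in> sets N" unfolding G_def by measurable
  \<comment> \<open>The default 0 off \<open>G\<close> keeps the values in \<open>[0, 1]\<close> and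
    antitone in the threshold at every point, not only at almost every one.\<close>
  define f where "f n t = (if t \<in> G then enn2real (g n t) else 0)" for n t
  have f_meas [measurable]: "f n \<in> borel_measurable N" for n unfolding f_def by measurable
  have g_top: "g n t < top" if "t \<in> G" for n t
    using that le_less_trans[of "g n t" 1 top] by (simp add: G_def)
  have f01: "0 \<le> f n t" "f n t \<le> 1" for n t
    by (auto simp: f_def G_def enn2real_leI)
  have f_mono: "f m t \<le> f n t" if "rat_enum n \<le> rat_enum m" for m n t
  proof (cases "t \<in> G")
    case True
    then have "g m t \<le> g n t" using that by (auto simp: G_def)
    then show ?thesis using enn2real_mono[OF _ g_top[OF True]] True by (simp add: f_def)
  qed (simp add: f_def)
  have f_AE: "AE t in \<rho>. ennreal (f n t) = g n t" for n
    using AE_good AE_space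
  proof eventually_elim
    case (elim t)
    then have "t \<in> G" by (simp add: G_def)
    then show ?case using g_top by (simp add: f_def)
  qed
  let ?Q = "\<lambda>p. tail_quantile (\<lambda>n. f n (fst p)) (snd p)"
  \<comment> \<open>Given \<open>t\<close>, the uniform variable lies below \<open>f n t\<close>
    with probability \<open>f n t\<close>; integrating over \<open>t\<close> in \<open>A\<close>
    recovers the joint tail.\<close>
  have E: "emeasure (\<rho> \<Otimes>\<^sub>M unit_uniform) {p\<in>A \<times> UNIV. snd p < f n (fst p)} = emeasure P (A \<times> {rat_enum n<..})"
    if [measurable]: "A \<in> sets N" for A n
  proof -
    have "emeasure (\<rho> \<Otimes>\<^sub>M unit_uniform) {p\<in>A \<times> UNIV. snd p < f n (fst p)}
        = (\<integral>\<^sup>+t. emeasure unit_uniform (Pair t -` {p\<in>A \<times> UNIV. snd p < f n (fst p)}) \<partial>\<rho>)"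
    proof (rule U.emeasure_pair_measure_alt)
      have "{p\<in>A \<times> UNIV. snd p < f n (fst p)} = {p\<in>space (N \<Otimes>\<^sub>M borel). fst p \<in> A \<and> snd p < f n (fst p)}"
        using sets.sets_into_space[OF that] by (auto simp: space_pair_measure)
      also have "\<dots> \<in> sets (\<rho> \<Otimes>\<^sub>M unit_uniform)" by measurable
      finally show "{p\<in>A \<times> UNIV. snd p < f n (fst p)} \<in> sets (\<rho> \<Otimes>\<^sub>M unit_uniform)" .
    qed
    also have "\<dots> = (\<integral>\<^sup>+t. g n t * indicator A t \<partial>\<rho>)"
    proof (rule nn_integral_cong_AE)
      show "AE t in \<rho>. emeasure unit_uniform (Pair t -` {p\<in>A \<times> UNIV. snd p < f n (fst p)}) = g n t * indicator A t"
        using f_AE[of n]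
      proof eventually_elim
        case (elim t)
        have "Pair t -` {p\<in>A \<times> UNIV. snd p < f n (fst p)} = (if t \<in> A then {..<f n t} else {})" by auto
        then show ?case using elim emeasure_unit_uniform_lessThan[OF f01, of n t] by simp
      qed
    qed
    finally show ?thesis using g that by simp
  qed
  have [measurable]: "?Q \<in> borel_measurable (\<rho> \<Otimes>\<^sub>M unit_uniform)" by measurable
  have Q: "emeasure (\<rho> \<Otimes>\<^sub>M unit_uniform) {p\<in>A \<times> UNIV. ereal x < ?Q p} = emeasure P (A \<times> {x<..})"
    if A: "A \<in> sets N" for A x
  proof -
    obtain r where r_gt: "\<And>k. x < rat_enum (r k)" and r_dec: "\<And>k. rat_enum (r (Suc k)) \<le> rat_enum (r k)"
      and r_lim: "\<And>y. x < y \<Longrightarrow> \<exists>k. rat_enum (r k) < y"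
      by (rule rat_enum_decreasing[of x]) blast
    \<comment> \<open>Every threshold above \<open>x\<close> lies above some
      \<open>rat_enum (r k)\<close>, where \<open>f\<close> is at least as large. So the thresholds
      along \<open>r\<close> suffice, and they give an increasing union.\<close>
    have "{p\<in>A \<times> UNIV. ereal x < ?Q p} = (\<Union>k. {p\<in>A \<times> UNIV. snd p < f (r k) (fst p)})"
      unfolding less_tail_quantile_iff using r_gt r_lim f_mono by (auto; meson less_imp_le less_le_trans)
    also have "emeasure (\<rho> \<Otimes>\<^sub>M unit_uniform) \<dots> = (SUP k. emeasure (\<rho> \<Otimes>\<^sub>M unit_uniform) {p\<in>A \<times> UNIV. snd p < f (r k) (fst p)})"
    proof (rule SUP_emeasure_incseq[symmetric])
      have "{p\<in>A \<times> UNIV. snd p < f (r k) (fst p)} = {p\<in>space (N \<Otimes>\<^sub>M borel). fst p \<in> A \<and> snd p < f (r k) (fst p)}" for k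
        using sets.sets_into_space[OF A] by (auto simp: space_pair_measure)
      moreover have "\<dots> k \<in> sets (\<rho> \<Otimes>\<^sub>M unit_uniform)" for k using A by measurable
      ultimately show "range (\<lambda>k. {p\<in>A \<times> UNIV. snd p < f (r k) (fst p)}) \<subseteq> sets (\<rho> \<Otimes>\<^sub>M unit_uniform)"
        by auto
      show "incseq (\<lambda>k. {p\<in>A \<times> UNIV. snd p < f (r k) (fst p)})"
        using f_mono[OF r_dec] by (auto intro!: incseq_SucI intro: less_le_trans)
    qed
    also have "\<dots> = (SUP k. emeasure P (A \<times> {rat_enum (r k)<..}))" using E[OF A] by simp
    also have "\<dots> = emeasure P (\<Union>k. A \<times> {rat_enum (r k)<..})"
    proof (rule SUP_emeasure_incseq)
      show "range (\<lambda>k. A \<times> {rat_enum (r k)<..}) \<subseteq> sets P" using A by (auto simp: P)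
      show "incseq (\<lambda>k. A \<times> {rat_enum (r k)<..})"
        using r_dec by (auto intro!: incseq_SucI intro: le_less_trans)
    qed
    also have "(\<Union>k. A \<times> {rat_enum (r k)<..}) = A \<times> {x<..}"
    proof -
      have "x < y" if "rat_enum (r k) < y" for k y using r_gt[of k] that by simp
      then show ?thesis using r_lim by auto
    qed
    finally show ?thesis .
  qed
  have QS: "{p\<in>space N \<times> UNIV. ereal x < ?Q p} \<in> sets (\<rho> \<Otimes>\<^sub>M unit_uniform)" for x
  proof -
    have "{p\<in>space (\<rho> \<Otimes>\<^sub>M unit_uniform). ereal x < ?Q p} \<in> sets (\<rho> \<Otimes>\<^sub>M unit_uniform)" by measurable
    then show ?thesis by (simp add: space_pair_measure)
  qed
  \<comment> \<open>The value is infinite only if it exceeds every \<open>k\<close>, and these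
    events have the probabilities of the tails of a real-valued coordinate, which tend to 0. The
    value minus infinity is excluded dually.\<close>
  have AE1: "AE p in \<rho> \<Otimes>\<^sub>M unit_uniform. ?Q p \<noteq> \<infinity>"
  proof -
    let ?B = "\<Inter>k::nat. {p\<in>space N \<times> UNIV. ereal (real k) < ?Q p}"
    have "emeasure (\<rho> \<Otimes>\<^sub>M unit_uniform) ?B = (INF k::nat. emeasure (\<rho> \<Otimes>\<^sub>M unit_uniform) {p\<in>space N \<times> UNIV. ereal (real k) < ?Q p})"
      by (rule INF_emeasure_decseq[symmetric])
        (use QS in \<open>auto simp: decseq_def intro: le_less_trans[rotated]\<close>)
    also have "\<dots> = (INF k::nat. emeasure P (space N \<times> {real k<..}))" by (simp add: Q)
    also have "\<dots> = emeasure P (\<Inter>k::nat. space N \<times> {real k<..})"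
      by (rule INF_emeasure_decseq) (auto simp: decseq_def P)
    also have "(\<Inter>k::nat. space N \<times> {real k<..}) = {}"
      using reals_Archimedean2 by (auto, meson less_asym)
    finally have "?B \<in> null_sets (\<rho> \<Otimes>\<^sub>M unit_uniform)" using QS by (intro null_setsI) auto
    then show ?thesis by (rule AE_I'[where N = ?B]) (auto simp: space_pair_measure)
  qed
  have AE2: "AE p in \<rho> \<Otimes>\<^sub>M unit_uniform. ?Q p \<noteq> - \<infinity>"
  proof -
    let ?B = "\<Union>k::nat. {p\<in>space N \<times> UNIV. ereal (- real k) < ?Q p}"
    have "emeasure (\<rho> \<Otimes>\<^sub>M unit_uniform) ?B = (SUP k::nat. emeasure (\<rho> \<Otimes>\<^sub>M unit_uniform) {p\<in>space N \<times> UNIV. ereal (- real k) < ?Q p})"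
      by (rule SUP_emeasure_incseq[symmetric])
        (use QS[of "- real k" for k] in \<open>auto simp: incseq_def intro: le_less_trans[rotated]\<close>)
    also have "\<dots> = (SUP k::nat. emeasure P (space N \<times> {- real k<..}))" using Q[OF sets.top] by simp
    also have "\<dots> = emeasure P (\<Union>k::nat. space N \<times> {- real k<..})"
      by (rule SUP_emeasure_incseq) (auto simp: incseq_def P)
    also have "(\<Union>k::nat. space N \<times> {- real k<..}) = space P"
    proof -
      have "\<exists>k::nat. - real k < y" for y using reals_Archimedean2[of "- y"] by (auto simp: minus_less_iff)
      then show ?thesis by (auto simp: spP)
    qed
    finally have "emeasure (\<rho> \<Otimes>\<^sub>M unit_uniform) ?B = 1" by (simp add: P.emeasure_space_1)
    moreover have "?B \<in> sets (\<rho> \<Otimes>\<^sub>M unit_uniform)" using QS by blast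
    ultimately have "AE p in \<rho> \<Otimes>\<^sub>M unit_uniform. p \<in> ?B"
      by (intro \<rho>U.P.AE_prob_1) (simp add: measure_def del: mem_simps)
    then show ?thesis by eventually_elim auto
  qed
  show thesis
  proof (rule that[OF f_meas])
    let ?R = "\<lambda>p. (fst p, real_of_ereal (tail_quantile (\<lambda>n. f n (fst p)) (snd p)))"
    have [measurable]: "?R \<in> measurable (\<rho> \<Otimes>\<^sub>M unit_uniform) (N \<Otimes>\<^sub>M borel)" by measurable
    have "P = distr (\<rho> \<Otimes>\<^sub>M unit_uniform) (N \<Otimes>\<^sub>M borel) ?R"
    proof (rule measure_eqI_pair_greaterThan[where N = N])
      fix A and x :: real assume A: "A \<in> sets N"
      have "emeasure (distr (\<rho> \<Otimes>\<^sub>M unit_uniform) (N \<Otimes>\<^sub>M borel) ?R) (A \<times> {x<..})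
          = emeasure (\<rho> \<Otimes>\<^sub>M unit_uniform) {p\<in>space (\<rho> \<Otimes>\<^sub>M unit_uniform). fst p \<in> A \<and> x < real_of_ereal (?Q p)}"
        using A by (subst emeasure_distr) (auto intro!: arg_cong[where f = "emeasure (\<rho> \<Otimes>\<^sub>M unit_uniform)"])
      \<comment> \<open>\<open>real_of_ereal\<close> sends both infinities to 0, which alters the
        event on a null set only.\<close>
      also have "\<dots> = emeasure (\<rho> \<Otimes>\<^sub>M unit_uniform) {p\<in>space (\<rho> \<Otimes>\<^sub>M unit_uniform). fst p \<in> A \<and> ereal x < ?Q p}"
      proof (rule emeasure_eq_AE)
        show "AE p in \<rho> \<Otimes>\<^sub>M unit_uniform. (p \<in> {p\<in>space (\<rho> \<Otimes>\<^sub>M unit_uniform). fst p \<in> A \<and> x < real_of_ereal (?Q p)})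
            = (p \<in> {p\<in>space (\<rho> \<Otimes>\<^sub>M unit_uniform). fst p \<in> A \<and> ereal x < ?Q p})"
          using AE1 AE2
        proof eventually_elim
          case (elim p)
          then show ?case by (cases "?Q p") auto
        qed
      qed (use A in measurable)
      also have "{p\<in>space (\<rho> \<Otimes>\<^sub>M unit_uniform). fst p \<in> A \<and> ereal x < ?Q p} = {p\<in>A \<times> UNIV. ereal x < ?Q p}"
        using sets.sets_into_space[OF A] by (auto simp: space_pair_measure)
      finally show "emeasure P (A \<times> {x<..}) = emeasure (distr (\<rho> \<Otimes>\<^sub>M unit_uniform) (N \<Otimes>\<^sub>M borel) ?R) (A \<times> {x<..})"
        using Q[OF A] by simp
    qed (use P P.finite_measure_axioms in auto)
    then show "P = distr (distr P N fst \<Otimes>\<^sub>M unit_uniform) (N \<Otimes>\<^sub>M borel) ?R"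
      by (simp add: \<rho>_def)
  qed
qed

subsection \<open>A parametrisation of the probability measures on the plane\<close>

fun ternary_digit :: "real \<Rightarrow> nat \<Rightarrow> bool" where
  "ternary_digit y 0 \<longleftrightarrow> 1 / 2 \<le> y"
| "ternary_digit y (Suc n) \<longleftrightarrow> ternary_digit (3 * y - (if 1 / 2 \<le> y then 2 else 0)) n"

text \<open>Digits 0 and 2 in base 3 are used instead of binary digits, so that distinct bit
  sequences have distinct sums and every bit can be recovered.\<close>

definition cantor_code :: "(nat \<Rightarrow> bool) \<Rightarrow> real" where
  "cantor_code b = (\<Sum>n. (if b n then 2 else 0) / 3 ^ Suc n)"

lemma sums_cantor_max: "(\<lambda>n. 2 / 3 ^ Suc n :: real) sums 1"
  using sums_mult[OF geometric_sums[of "1 / 3 :: real"], of "2 / 3"]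
  by (simp add: power_one_over field_simps)

lemma summable_cantor_code: "summable (\<lambda>n. (if b n then 2 else 0) / 3 ^ Suc n :: real)"
  by (rule summable_comparison_test'[OF sums_summable[OF sums_cantor_max], of 0]) auto

lemma cantor_code_bounds: "0 \<le> cantor_code b" "cantor_code b \<le> 1"
proof -
  show "0 \<le> cantor_code b"
    unfolding cantor_code_def by (intro suminf_nonneg summable_cantor_code) auto
  have "cantor_code b \<le> (\<Sum>n. 2 / 3 ^ Suc n)"
    unfolding cantor_code_def
    by (intro suminf_le summable_cantor_code sums_summable[OF sums_cantor_max]) (auto simp: divide_right_mono)
  then show "cantor_code b \<le> 1" using sums_unique[OF sums_cantor_max] by simp
qed

lemma cantor_code_rec: "3 * cantor_code b = (if b 0 then 2 else 0) + cantor_code (\<lambda>n. b (Suc n))"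
proof -
  have "cantor_code b = (\<Sum>n. (if b (Suc n) then 2 else 0) / 3 ^ Suc (Suc n)) + (if b 0 then 2 else 0) / 3"
    unfolding cantor_code_def using suminf_split_head[OF summable_cantor_code[of b]] by simp
  also have "(\<Sum>n. (if b (Suc n) then 2 else 0) / 3 ^ Suc (Suc n)) = cantor_code (\<lambda>n. b (Suc n)) / 3"
    unfolding cantor_code_def
    by (subst suminf_divide[OF summable_cantor_code, symmetric]) (simp add: mult.commute)
  finally show ?thesis by simp
qed

text \<open>The value lies in \<open>[0, 1/3]\<close> or in \<open>[2/3, 1]\<close> according to the
  leading bit, and the threshold \<open>1/2\<close> falls into the gap.\<close>

lemma cantor_code_ge_half_iff: "1 / 2 \<le> cantor_code b \<longleftrightarrow> b 0"
proof (cases "b 0")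
  case True
  then show ?thesis
    using cantor_code_rec[of b] cantor_code_bounds(1)[of "\<lambda>n. b (Suc n)"] by simp
next
  case False
  then have "3 * cantor_code b \<le> 1"
    using cantor_code_rec[of b] cantor_code_bounds(2)[of "\<lambda>n. b (Suc n)"] by simp
  then show ?thesis using False by simp
qed

lemma ternary_digit_cantor_code: "ternary_digit (cantor_code b) n \<longleftrightarrow> b n"
proof (induction n arbitrary: b)
  case 0
  show ?case unfolding ternary_digit.simps by (rule cantor_code_ge_half_iff)
next
  case (Suc n)
  have "3 * cantor_code b - (if 1 / 2 \<le> cantor_code b then 2 else 0) = cantor_code (\<lambda>n. b (Suc n))"
    unfolding cantor_code_ge_half_iff cantor_code_rec[of b] by simp
  then show ?case unfolding ternary_digit.simps using Suc[of "\<lambda>n. b (Suc n)"] by simp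
qed

lemma measurable_ternary_digit [measurable (raw)]:
  "h \<in> borel_measurable M \<Longrightarrow> Measurable.pred M (\<lambda>x. ternary_digit (h x) n)"
proof (induction n arbitrary: h)
  case 0
  note [measurable] = 0
  show ?case by simp
next
  case (Suc n)
  note [measurable] = Suc.prems
  show ?case unfolding ternary_digit.simps by (rule Suc.IH) measurable
qed

lemma tail_quantile_cut: "tail_quantile (\<lambda>n. of_bool (rat_enum n < x)) 0 = ereal x"
proof (rule antisym)
  show "tail_quantile (\<lambda>n. of_bool (rat_enum n < x)) 0 \<le> ereal x"
    unfolding tail_quantile_def by (rule SUP_least) auto
  show "ereal x \<le> tail_quantile (\<lambda>n. of_bool (rat_enum n < x)) 0"
  proof (rule ccontr)
    assume "\<not> ?thesis"
    then have "tail_quantile (\<lambda>n. of_bool (rat_enum n < x)) 0 < ereal x" by (simp add: not_le)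
    from ereal_dense2[OF this] obtain y where
      y: "tail_quantile (\<lambda>n. of_bool (rat_enum n < x)) 0 < ereal y" "y < x"
      by auto
    then obtain n where "y < rat_enum n" "rat_enum n < x" using rat_enum_between by blast
    then have "ereal y < tail_quantile (\<lambda>n. of_bool (rat_enum n < x)) 0"
      unfolding less_tail_quantile_iff by auto
    with y show False by simp
  qed
qed

text \<open>The two Dedekind cuts are interleaved into one bit sequence, which is stored in the ternary digits
  of a point of the Cantor set.\<close>
definition encode_pair :: "real \<times> real \<Rightarrow> real" where
  "encode_pair p = cantor_code (\<lambda>n. rat_enum (n div 2) < (if even n then fst p else snd p))"

definition decode_pair :: "real \<Rightarrow> real \<times> real" where
  "decode_pair y = (real_of_ereal (tail_quantile (\<lambda>n. of_bool (ternary_digit y (2 * n))) 0),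
     real_of_ereal (tail_quantile (\<lambda>n. of_bool (ternary_digit y (2 * n + 1))) 0))"

lemma decode_encode_pair: "decode_pair (encode_pair p) = p"
  unfolding decode_pair_def encode_pair_def ternary_digit_cantor_code
  by (simp add: tail_quantile_cut)

lemma measurable_encode_pair [measurable]: "encode_pair \<in> borel_measurable borel"
proof -
  have [measurable]: "fst \<in> borel_measurable (borel :: (real \<times> real) measure)"
    "snd \<in> borel_measurable (borel :: (real \<times> real) measure)"
    by (auto intro!: borel_measurable_continuous_onI continuous_intros)
  show ?thesis unfolding encode_pair_def[abs_def] cantor_code_def by measurable
qed

lemma measurable_decode_pair [measurable]: "decode_pair \<in> borel_measurable borel"
  unfolding decode_pair_def[abs_def] borel_prod[symmetric] by measurable

section \<open>Laws on the line and on the plane as images of the uniform variable\<close>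

lemma ex_tail_quantile_distr:
  fixes M :: "real measure"
  assumes M: "prob_space M" "sets M = sets borel"
  shows "\<exists>z. M = distr unit_uniform borel (\<lambda>w. real_of_ereal (tail_quantile z w))"
proof -
  interpret M: prob_space M by fact
  interpret U: prob_space unit_uniform by (rule prob_space_unit_uniform)
  note [measurable_cong] = M(2)
  \<comment> \<open>A constant first coordinate makes the conditional tail probabilities
    unconditional; they are read off at the point 0.\<close>
  define P where "P = distr M (borel \<Otimes>\<^sub>M borel) (\<lambda>x. (0 :: real, x))"
  have "prob_space P" unfolding P_def by (rule M.prob_space_distr) measurable
  moreover have "sets P = sets (borel \<Otimes>\<^sub>M borel)" by (simp add: P_def)
  ultimately obtain f where [measurable]: "\<And>n. f n \<in> borel_measurable borel"
    and P: "P = distr (distr P borel fst \<Otimes>\<^sub>M unit_uniform) (borel \<Otimes>\<^sub>M borel)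
               (\<lambda>p. (fst p, real_of_ereal (tail_quantile (\<lambda>n. f n (fst p)) (snd p))))"
    using noise_outsourcing[of P borel] by blast
  let ?h = "\<lambda>t w. real_of_ereal (tail_quantile (\<lambda>n. f n t) w)"
  have "M = distr unit_uniform borel (?h 0)"
  proof (rule measure_eqI)
    fix A assume "A \<in> sets M"
    then have [measurable]: "A \<in> sets borel" by (simp add: M)
    have "emeasure M A = (\<integral>\<^sup>+x. indicator A x \<partial>M)" by (simp add: M)
    also have "\<dots> = (\<integral>\<^sup>+p. indicator A (snd p) \<partial>P)" unfolding P_def by (subst nn_integral_distr) auto
    also have "\<dots> = (\<integral>\<^sup>+p. indicator A (?h (fst p) (snd p)) \<partial>(distr P borel fst \<Otimes>\<^sub>M unit_uniform))"
      by (subst P, subst nn_integral_distr) auto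
    also have "\<dots> = (\<integral>\<^sup>+t. \<integral>\<^sup>+w. indicator A (?h t w) \<partial>unit_uniform \<partial>distr P borel fst)"
      by (subst U.nn_integral_fst[symmetric]) auto
    also have "\<dots> = (\<integral>\<^sup>+w. indicator A (?h 0 w) \<partial>unit_uniform)"
      unfolding P_def by (subst nn_integral_distr, simp, simp, subst nn_integral_distr) (auto simp: M.emeasure_space_1)
    also have "\<dots> = (\<integral>\<^sup>+x. indicator A x \<partial>distr unit_uniform borel (?h 0))"
      by (subst nn_integral_distr) auto
    finally show "emeasure M A = emeasure (distr unit_uniform borel (?h 0)) A" by simp
  qed (simp add: M)
  then show ?thesis by blast
qed

text \<open>The value is unspecified for sequences along which the rationals diverge; only measurability and
  surjectivity matter.\<close>
definition real_of_seq :: "(nat \<Rightarrow> nat) \<Rightarrow> real" where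
  "real_of_seq z = lim (\<lambda>k. rat_enum (z k))"

lemma ex_real_of_seq: "\<exists>z. real_of_seq z = x"
proof -
  have "\<exists>n. x < rat_enum n \<and> rat_enum n < x + 1 / real (Suc k)" for k
    by (rule rat_enum_between[of x "x + 1 / real (Suc k)"]) auto
  then obtain z where z: "\<And>k. x < rat_enum (z k)" "\<And>k. rat_enum (z k) < x + 1 / real (Suc k)"
    by metis
  have "(\<lambda>k. rat_enum (z k)) \<longlonglongrightarrow> x"
  proof (rule tendsto_sandwich[OF _ _ tendsto_const])
    show "(\<lambda>k. x + 1 / real (Suc k)) \<longlonglongrightarrow> x"
      using tendsto_add[OF tendsto_const[of x] LIMSEQ_inverse_real_of_nat] by (simp add: inverse_eq_divide)
  qed (use z in \<open>auto intro!: always_eventually less_imp_le\<close>)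
  then show ?thesis unfolding real_of_seq_def by (intro exI[of _ z] limI)
qed

text \<open>The parameter holds one sequence of naturals for each threshold, decoded to a real tail
  value; the quantile then draws the code of a point of the plane. Every stage is total and Borel,
  so the whole Baire space serves as parameter space.\<close>

definition pair_sampler :: "(nat \<Rightarrow> nat) \<Rightarrow> real \<Rightarrow> real \<times> real" where
  "pair_sampler z w =
     decode_pair (real_of_ereal (tail_quantile (\<lambda>n. real_of_seq (\<lambda>k. z (prod_encode (n, k)))) w))"

lemma measurable_pair_sampler:
  "(\<lambda>p. pair_sampler (fst p) (snd p)) \<in> borel_measurable (borel \<Otimes>\<^sub>M borel)"
proof -
  have [measurable]: "(\<lambda>p :: (nat \<Rightarrow> nat) \<times> real. rat_enum (fst p i)) \<in> borel_measurable (borel \<Otimes>\<^sub>M borel)" for i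
  proof -
    have "(\<lambda>z :: nat \<Rightarrow> nat. z i) \<in> borel \<rightarrow>\<^sub>M (borel :: nat measure)"
      by (rule borel_measurable_continuous_onI) simp
    moreover have "rat_enum \<in> (borel :: nat measure) \<rightarrow>\<^sub>M borel"
      by (rule borel_measurable_continuous_onI) (simp add: continuous_on_open_vimage discrete_topology_class.open_discrete)
    ultimately show ?thesis by measurable
  qed
  show ?thesis unfolding pair_sampler_def real_of_seq_def by measurable
qed

text \<open>The law is transported to the line by \<open>encode_pair\<close>, sampled there, and
  brought back by \<open>decode_pair\<close>.\<close>

lemma ex_pair_sampler_distr:
  fixes \<pi> :: "(real \<times> real) measure"
  assumes \<pi>: "prob_space \<pi>" "sets \<pi> = sets borel"
  shows "\<exists>z. \<pi> = distr unit_uniform borel (pair_sampler z)"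
proof -
  interpret \<pi>: prob_space \<pi> by fact
  note [measurable_cong] = \<pi>(2)
  have "prob_space (distr \<pi> borel encode_pair)" by (rule \<pi>.prob_space_distr) measurable
  then obtain u where u: "distr \<pi> borel encode_pair = distr unit_uniform borel (\<lambda>w. real_of_ereal (tail_quantile u w))"
    using ex_tail_quantile_distr[of "distr \<pi> borel encode_pair"] by auto
  obtain v where v: "\<And>n. real_of_seq (v n) = u n" using ex_real_of_seq[of "u n" for n] by metis
  define z where "z i = v (fst (prod_decode i)) (snd (prod_decode i))" for i
  have "\<pi> = distr \<pi> borel (\<lambda>p. decode_pair (encode_pair p))"
    by (simp add: decode_encode_pair distr_id2 \<pi>)
  also have "\<dots> = distr (distr \<pi> borel encode_pair) borel decode_pair"
    by (subst distr_distr) (auto simp: o_def)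
  also have "\<dots> = distr unit_uniform borel (\<lambda>w. decode_pair (real_of_ereal (tail_quantile u w)))"
    unfolding u by (subst distr_distr) (auto simp: o_def)
  also have "(\<lambda>w. decode_pair (real_of_ereal (tail_quantile u w))) = pair_sampler z"
    by (auto simp: pair_sampler_def z_def v)
  finally show ?thesis by blast
qed

subsection \<open>Gluing and the triangle inequality in one dimension\<close>

lemma measurable_comp2_real:
  fixes d1 :: "real \<Rightarrow> real \<Rightarrow> real"
  assumes "(\<lambda>p. d1 (fst p) (snd p)) \<in> borel_measurable borel"
    and [measurable]: "f \<in> borel_measurable M" "g \<in> borel_measurable M"
  shows "(\<lambda>x. d1 (f x) (g x)) \<in> borel_measurable M"
proof -
  have "(\<lambda>x. (f x, g x)) \<in> M \<rightarrow>\<^sub>M borel" unfolding borel_prod[symmetric] by measurable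
  from measurable_compose[OF this assms(1)] show ?thesis by simp
qed

text \<open>Writing costs through random variables on one probability space lets the three couplings
  of the triangle inequality be compared pointwise.\<close>

lemma fgw_cost_distr:
  assumes \<Omega>: "prob_space \<Omega>" and [measurable]: "X \<in> borel_measurable \<Omega>" "Y \<in> borel_measurable \<Omega>"
    and d1: "(\<lambda>p. d1 (fst p) (snd p)) \<in> borel_measurable borel"
  shows "fgw_cost \<beta> d1 (distr \<Omega> borel (\<lambda>w. (X w, Y w))) =
     ennreal (1 - \<beta>) * (\<integral>\<^sup>+w. ennreal (d1 (X w) (Y w)) \<partial>\<Omega>)
   + ennreal \<beta> * (\<integral>\<^sup>+w. \<integral>\<^sup>+w'. ennreal ((d1 (X w) (X w') - d1 (Y w) (Y w'))\<^sup>2) \<partial>\<Omega> \<partial>\<Omega>)"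
proof -
  interpret prob_space \<Omega> by fact
  note [measurable (raw)] = measurable_comp2_real[OF d1]
  have XY [measurable]: "(\<lambda>w. (X w, Y w)) \<in> \<Omega> \<rightarrow>\<^sub>M borel" unfolding borel_prod[symmetric] by measurable
  have [measurable]: "fst \<in> borel_measurable (borel :: (real \<times> real) measure)"
    "snd \<in> borel_measurable (borel :: (real \<times> real) measure)"
    by (auto intro!: borel_measurable_continuous_onI continuous_intros)
  have "(\<integral>\<^sup>+p. ennreal (d1 (fst p) (snd p)) \<partial>distr \<Omega> borel (\<lambda>w. (X w, Y w)))
      = (\<integral>\<^sup>+w. ennreal (d1 (X w) (Y w)) \<partial>\<Omega>)"
    by (subst nn_integral_distr) auto
  moreover have "(\<integral>\<^sup>+q. ennreal ((d1 (fst p) (fst q) - d1 (snd p) (snd q))\<^sup>2) \<partial>distr \<Omega> borel (\<lambda>w. (X w, Y w)))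
      = (\<integral>\<^sup>+w'. ennreal ((d1 (fst p) (X w') - d1 (snd p) (Y w'))\<^sup>2) \<partial>\<Omega>)" for p
    by (subst nn_integral_distr) auto
  moreover have "(\<integral>\<^sup>+p. \<integral>\<^sup>+w'. ennreal ((d1 (fst p) (X w') - d1 (snd p) (Y w'))\<^sup>2) \<partial>\<Omega> \<partial>distr \<Omega> borel (\<lambda>w. (X w, Y w)))
      = (\<integral>\<^sup>+w. \<integral>\<^sup>+w'. ennreal ((d1 (X w) (X w') - d1 (Y w) (Y w'))\<^sup>2) \<partial>\<Omega> \<partial>\<Omega>)"
    by (subst nn_integral_distr) auto
  ultimately show ?thesis unfolding fgw_cost_def by simp
qed

lemma fgw_cost_triangle:
  assumes \<Omega>: "prob_space \<Omega>"
    and [measurable]: "X \<in> borel_measurable \<Omega>" "Y \<in> borel_measurable \<Omega>" "Z \<in> borel_measurable \<Omega>"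
    and d1: "(\<lambda>p. d1 (fst p) (snd p)) \<in> borel_measurable borel"
    and nonneg: "\<And>x y. 0 \<le> d1 x y"
    and tri: "\<And>x y z. d1 x z \<le> C * (d1 x y + d1 y z)" and K: "2 \<le> K" "C \<le> K"
  shows "fgw_cost \<beta> d1 (distr \<Omega> borel (\<lambda>w. (X w, Z w)))
    \<le> ennreal K * (fgw_cost \<beta> d1 (distr \<Omega> borel (\<lambda>w. (X w, Y w))) + fgw_cost \<beta> d1 (distr \<Omega> borel (\<lambda>w. (Y w, Z w))))"
proof -
  interpret prob_space \<Omega> by fact
  note [measurable (raw)] = measurable_comp2_real[OF d1]
  have triK: "ennreal (d1 x z) \<le> ennreal K * (ennreal (d1 x y) + ennreal (d1 y z))" for x y z
  proof -
    have "C * (d1 x y + d1 y z) \<le> K * (d1 x y + d1 y z)"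
      using K nonneg by (intro mult_right_mono add_nonneg_nonneg) auto
    then have "d1 x z \<le> K * (d1 x y + d1 y z)" using tri[of x z y] by simp
    then show ?thesis
      using K nonneg by (simp flip: ennreal_plus ennreal_mult add: ennreal_leI)
  qed
  have sqK: "ennreal ((a - c)\<^sup>2) \<le> ennreal K * (ennreal ((a - b)\<^sup>2) + ennreal ((b - c)\<^sup>2))" for a b c :: real
  proof -
    \<comment> \<open>The right side minus the left side is the square of
      \<open>(a - b) - (b - c)\<close>.\<close>
    have "(a - c)\<^sup>2 \<le> 2 * ((a - b)\<^sup>2 + (b - c)\<^sup>2)"
      using zero_le_power2[of "(a - b) - (b - c)"] by (simp add: power2_eq_square algebra_simps)
    also have "\<dots> \<le> K * ((a - b)\<^sup>2 + (b - c)\<^sup>2)" using K by (intro mult_right_mono) auto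
    finally show ?thesis
      using K by (simp flip: ennreal_plus ennreal_mult add: ennreal_leI)
  qed
  have "(\<integral>\<^sup>+w. ennreal (d1 (X w) (Z w)) \<partial>\<Omega>) \<le> (\<integral>\<^sup>+w. ennreal K * (ennreal (d1 (X w) (Y w)) + ennreal (d1 (Y w) (Z w))) \<partial>\<Omega>)"
    by (intro nn_integral_mono triK)
  also have "\<dots> = ennreal K * ((\<integral>\<^sup>+w. ennreal (d1 (X w) (Y w)) \<partial>\<Omega>) + (\<integral>\<^sup>+w. ennreal (d1 (Y w) (Z w)) \<partial>\<Omega>))"
    by (simp add: nn_integral_cmult nn_integral_add)
  finally have 1: "(\<integral>\<^sup>+w. ennreal (d1 (X w) (Z w)) \<partial>\<Omega>)
    \<le> ennreal K * ((\<integral>\<^sup>+w. ennreal (d1 (X w) (Y w)) \<partial>\<Omega>) + (\<integral>\<^sup>+w. ennreal (d1 (Y w) (Z w)) \<partial>\<Omega>))" .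
  let ?I = "\<lambda>X Y. \<integral>\<^sup>+w. \<integral>\<^sup>+w'. ennreal ((d1 (X w) (X w') - d1 (Y w) (Y w'))\<^sup>2) \<partial>\<Omega> \<partial>\<Omega>"
  have "?I X Z \<le> (\<integral>\<^sup>+w. \<integral>\<^sup>+w'. ennreal K * (ennreal ((d1 (X w) (X w') - d1 (Y w) (Y w'))\<^sup>2)
      + ennreal ((d1 (Y w) (Y w') - d1 (Z w) (Z w'))\<^sup>2)) \<partial>\<Omega> \<partial>\<Omega>)"
    by (intro nn_integral_mono sqK)
  also have "\<dots> = ennreal K * (?I X Y + ?I Y Z)"
    by (simp add: nn_integral_cmult nn_integral_add)
  finally have 2: "?I X Z \<le> ennreal K * (?I X Y + ?I Y Z)" .
  have "ennreal (1 - \<beta>) * (\<integral>\<^sup>+w. ennreal (d1 (X w) (Z w)) \<partial>\<Omega>) + ennreal \<beta> * ?I X Z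
    \<le> ennreal (1 - \<beta>) * (ennreal K * ((\<integral>\<^sup>+w. ennreal (d1 (X w) (Y w)) \<partial>\<Omega>) + (\<integral>\<^sup>+w. ennreal (d1 (Y w) (Z w)) \<partial>\<Omega>)))
      + ennreal \<beta> * (ennreal K * (?I X Y + ?I Y Z))"
    by (intro add_mono mult_left_mono 1 2) auto
  then show ?thesis
    using assms by (simp add: fgw_cost_distr distrib_left ac_simps)
qed

text \<open>The middle coordinate is drawn from the common marginal; two independent uniform
  variables then produce the outer coordinates from it, which makes these conditionally
  independent.\<close>

lemma couplings_gluing:
  assumes \<pi>: "\<pi> \<in> couplings \<rho> \<eta>" and \<tau>: "\<tau> \<in> couplings \<eta> \<zeta>"
  obtains \<Omega> :: "((real \<times> real) \<times> real) measure" and X Y Z where "prob_space \<Omega>"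
    and "X \<in> borel_measurable \<Omega>" "Y \<in> borel_measurable \<Omega>" "Z \<in> borel_measurable \<Omega>"
    and "\<pi> = distr \<Omega> borel (\<lambda>w. (X w, Y w))" "\<tau> = distr \<Omega> borel (\<lambda>w. (Y w, Z w))"
proof -
  have p: "prob_space \<pi>" "sets \<pi> = sets (borel \<Otimes>\<^sub>M borel)" "distr \<pi> borel snd = \<eta>"
    and t: "prob_space \<tau>" "sets \<tau> = sets (borel \<Otimes>\<^sub>M borel)" "distr \<tau> borel fst = \<eta>"
    using \<pi> \<tau> unfolding couplings_def borel_prod by auto
  note [measurable_cong] = p(2) t(2)
  interpret \<pi>: prob_space \<pi> by fact
  interpret \<tau>: prob_space \<tau> by fact
  interpret U: prob_space unit_uniform by (rule prob_space_unit_uniform)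
  have sets_\<eta>[measurable_cong]: "sets \<eta> = sets borel" using p(3) by auto
  have "prob_space \<eta>" unfolding p(3)[symmetric] by (rule \<pi>.prob_space_distr) measurable
  then interpret \<eta>: prob_space \<eta> .
  interpret \<eta>U: pair_prob_space \<eta> unit_uniform ..
  let ?Q = "\<lambda>f p. real_of_ereal (tail_quantile (\<lambda>n. f n (fst p)) (snd p))"
  \<comment> \<open>Swapped, so that the common marginal is the first coordinate, on which noise
    outsourcing conditions.\<close>
  define P where "P = distr \<pi> (borel \<Otimes>\<^sub>M borel) (\<lambda>p. (snd p, fst p))"
  have P1: "prob_space P" unfolding P_def by (rule \<pi>.prob_space_distr) measurable
  have P2: "sets P = sets (borel \<Otimes>\<^sub>M borel)" by (simp add: P_def)
  have P3: "distr P borel fst = \<eta>"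
    unfolding P_def p(3)[symmetric] by (subst distr_distr) (auto simp: o_def)
  obtain f where [measurable]: "\<And>n. f n \<in> borel_measurable borel"
    and f: "P = distr (\<eta> \<Otimes>\<^sub>M unit_uniform) (borel \<Otimes>\<^sub>M borel) (\<lambda>p. (fst p, ?Q f p))"
    using noise_outsourcing[OF P1 P2, unfolded P3] by blast
  obtain g where [measurable]: "\<And>n. g n \<in> borel_measurable borel"
    and g: "\<tau> = distr (\<eta> \<Otimes>\<^sub>M unit_uniform) (borel \<Otimes>\<^sub>M borel) (\<lambda>p. (fst p, ?Q g p))"
    using noise_outsourcing[OF t(1,2), unfolded t(3)] by blast
  let ?\<Omega> = "(\<eta> \<Otimes>\<^sub>M unit_uniform) \<Otimes>\<^sub>M unit_uniform"
  \<comment> \<open>The middle coordinate paired with either of the two noises has the same law, so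
    both representations can be realised on \<open>?\<Omega>\<close>.\<close>
  have fst_law: "distr ?\<Omega> (\<eta> \<Otimes>\<^sub>M unit_uniform) fst = \<eta> \<Otimes>\<^sub>M unit_uniform"
    by (rule U.distr_pair_fst)
  have skip_law: "\<eta> \<Otimes>\<^sub>M unit_uniform = distr ?\<Omega> (\<eta> \<Otimes>\<^sub>M unit_uniform) (\<lambda>w. (fst (fst w), snd w))"
  proof (rule pair_measure_eqI)
    fix A B assume A: "A \<in> sets \<eta>" and B: "B \<in> sets unit_uniform"
    have "emeasure (distr ?\<Omega> (\<eta> \<Otimes>\<^sub>M unit_uniform) (\<lambda>w. (fst (fst w), snd w))) (A \<times> B)
        = emeasure ?\<Omega> ((A \<times> space unit_uniform) \<times> B)"
      using A B sets.sets_into_space[OF A]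
      by (subst emeasure_distr) (auto simp: space_pair_measure intro!: arg_cong[where f = "emeasure ?\<Omega>"])
    also have "\<dots> = emeasure (\<eta> \<Otimes>\<^sub>M unit_uniform) (A \<times> space unit_uniform) * emeasure unit_uniform B"
      using A B by (intro U.emeasure_pair_measure_Times pair_measureI) auto
    also have "emeasure (\<eta> \<Otimes>\<^sub>M unit_uniform) (A \<times> space unit_uniform) = emeasure \<eta> A"
      using U.emeasure_pair_measure_Times[OF A sets.top] U.emeasure_space_1 by simp
    finally show "emeasure \<eta> A * emeasure unit_uniform B
        = emeasure (distr ?\<Omega> (\<eta> \<Otimes>\<^sub>M unit_uniform) (\<lambda>w. (fst (fst w), snd w))) (A \<times> B)" by simp
  qed (auto intro: \<eta>.sigma_finite_measure_axioms U.sigma_finite_measure_axioms)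
  show thesis
  proof (rule that[of ?\<Omega> "\<lambda>w. ?Q f (fst w)" "\<lambda>w. fst (fst w)" "\<lambda>w. ?Q g (fst (fst w), snd w)"])
    show "prob_space ?\<Omega>"
      by (intro prob_space_pair \<eta>.prob_space_axioms U.prob_space_axioms)
    have "\<pi> = distr \<pi> (borel \<Otimes>\<^sub>M borel) (\<lambda>p. (fst p, snd p))"
      by (simp add: distr_id2 p(2))
    also have "\<dots> = distr P (borel \<Otimes>\<^sub>M borel) (\<lambda>p. (snd p, fst p))"
      unfolding P_def by (subst distr_distr) (auto simp: o_def)
    also have "\<dots> = distr (\<eta> \<Otimes>\<^sub>M unit_uniform) (borel \<Otimes>\<^sub>M borel) (\<lambda>p. (?Q f p, fst p))"
      unfolding f by (subst distr_distr) (auto simp: o_def)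
    also have "\<dots> = distr ?\<Omega> (borel \<Otimes>\<^sub>M borel) (\<lambda>w. (?Q f (fst w), fst (fst w)))"
      by (subst fst_law[symmetric], subst distr_distr) (auto simp: o_def)
    finally show "\<pi> = distr ?\<Omega> borel (\<lambda>w. (?Q f (fst w), fst (fst w)))"
      unfolding borel_prod .
    have "\<tau> = distr ?\<Omega> (borel \<Otimes>\<^sub>M borel) (\<lambda>w. (fst (fst w), ?Q g (fst (fst w), snd w)))"
      by (subst g, subst skip_law, subst distr_distr) (auto simp: o_def)
    then show "\<tau> = distr ?\<Omega> borel (\<lambda>w. (fst (fst w), ?Q g (fst (fst w), snd w)))"
      unfolding borel_prod .
  qed measurable
qed

text \<open>Choosing \<open>a\<close> and \<open>b\<close> within \<open>e / (2 * K)\<close> of the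
  infima costs \<open>e\<close> in total after multiplication by \<open>K\<close>. An infinite
  infimum, for instance over an empty set, makes the right side infinite.\<close>

lemma ennreal_le_mult_add_INF:
  fixes f g :: "_ \<Rightarrow> ennreal"
  assumes K: "0 < K" and le: "\<And>a b. a \<in> A \<Longrightarrow> b \<in> B \<Longrightarrow> x \<le> ennreal K * (f a + g b)"
  shows "x \<le> ennreal K * ((INF a\<in>A. f a) + (INF b\<in>B. g b))"
proof (rule ennreal_le_epsilon)
  let ?I = "INF a\<in>A. f a" and ?J = "INF b\<in>B. g b"
  fix e :: real assume fin: "ennreal K * (?I + ?J) < top" and e: "0 < e"
  have "ennreal K * top = top" using K by (simp add: ennreal_mult_top)
  then have "?I \<noteq> \<infinity>" "?J \<noteq> \<infinity>" using fin by fastforce+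
  moreover have pos: "0 < e / (2 * K)" using e K by simp
  ultimately obtain a b where ab: "a \<in> A" "f a < ?I + ennreal (e / (2 * K))" "b \<in> B" "g b < ?J + ennreal (e / (2 * K))"
    using INF_approx_ennreal[OF pos refl, of f A] INF_approx_ennreal[OF pos refl, of g B] by auto
  have "x \<le> ennreal K * (f a + g b)" using le ab by blast
  also have "\<dots> \<le> ennreal K * ((?I + ennreal (e / (2 * K))) + (?J + ennreal (e / (2 * K))))"
    using ab by (intro mult_left_mono add_mono) auto
  also have "\<dots> = ennreal K * (?I + ?J) + ennreal K * (ennreal (e / (2 * K)) + ennreal (e / (2 * K)))"
    by (simp add: distrib_left ac_simps)
  also have "ennreal K * (ennreal (e / (2 * K)) + ennreal (e / (2 * K))) = ennreal e"
    using e K by (simp flip: ennreal_plus ennreal_mult)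
  finally show "x \<le> ennreal K * (?I + ?J) + ennreal e" .
qed

lemma distr_pair_in_couplings:
  assumes "prob_space \<Omega>" and [measurable]: "X \<in> borel_measurable \<Omega>" "Y \<in> borel_measurable \<Omega>"
  shows "distr \<Omega> borel (\<lambda>w. (X w, Y w)) \<in> couplings (distr \<Omega> borel X) (distr \<Omega> borel Y)"
proof -
  have "(\<lambda>w. (X w, Y w)) \<in> \<Omega> \<rightarrow>\<^sub>M borel" unfolding borel_prod[symmetric] by measurable
  moreover have "fst \<in> borel_measurable (borel :: (real \<times> real) measure)"
    "snd \<in> borel_measurable (borel :: (real \<times> real) measure)"
    by (auto intro!: borel_measurable_continuous_onI continuous_intros)
  ultimately show ?thesis
    using assms(1) by (auto simp: couplings_def distr_distr o_def intro: prob_space.prob_space_distr)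
qed

lemma D_fgw_triangle:
  assumes d1: "(\<lambda>p. d1 (fst p) (snd p)) \<in> borel_measurable borel"
    and nonneg: "\<And>x y. 0 \<le> d1 x y"
    and tri: "\<And>x y z. d1 x z \<le> C * (d1 x y + d1 y z)" and K: "2 \<le> K" "C \<le> K"
  shows "D_fgw \<rho> \<zeta> \<beta> d1 \<le> ennreal K * (D_fgw \<rho> \<eta> \<beta> d1 + D_fgw \<eta> \<zeta> \<beta> d1)"
  unfolding D_fgw_def[of \<rho> \<eta>] D_fgw_def[of \<eta> \<zeta>]
proof (rule ennreal_le_mult_add_INF)
  fix \<pi> \<tau> assume \<pi>: "\<pi> \<in> couplings \<rho> \<eta>" and \<tau>: "\<tau> \<in> couplings \<eta> \<zeta>"
  then obtain \<Omega> :: "((real \<times> real) \<times> real) measure" and X Y Z where \<Omega>: "prob_space \<Omega>"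
    and m: "X \<in> borel_measurable \<Omega>" "Y \<in> borel_measurable \<Omega>" "Z \<in> borel_measurable \<Omega>"
    and eq: "\<pi> = distr \<Omega> borel (\<lambda>w. (X w, Y w))" "\<tau> = distr \<Omega> borel (\<lambda>w. (Y w, Z w))"
    by (rule couplings_gluing)
  have "\<rho> = distr \<Omega> borel X" "\<zeta> = distr \<Omega> borel Z"
    using \<pi> \<tau> distr_pair_in_couplings[OF \<Omega> m(1,2)] distr_pair_in_couplings[OF \<Omega> m(2,3)]
    by (auto simp: couplings_def eq)
  then have "D_fgw \<rho> \<zeta> \<beta> d1 \<le> fgw_cost \<beta> d1 (distr \<Omega> borel (\<lambda>w. (X w, Z w)))"
    unfolding D_fgw_def using distr_pair_in_couplings[OF \<Omega> m(1,3)] by (auto intro: INF_lower)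
  also have "\<dots> \<le> ennreal K * (fgw_cost \<beta> d1 \<pi> + fgw_cost \<beta> d1 \<tau>)"
    unfolding eq using \<Omega> m d1 nonneg tri K by (rule fgw_cost_triangle)
  finally show "D_fgw \<rho> \<zeta> \<beta> d1 \<le> ennreal K * (fgw_cost \<beta> d1 \<pi> + fgw_cost \<beta> d1 \<tau>)" .
qed (use K in simp)

text \<open>Swapping coordinates maps couplings to couplings of equal cost, because
  \<open>d1\<close> is symmetric and the square is even.\<close>

lemma D_fgw_commute:
  assumes d1: "(\<lambda>p. d1 (fst p) (snd p)) \<in> borel_measurable borel" and sym: "\<And>x y. d1 x y = d1 y x"
  shows "D_fgw \<rho> \<eta> \<beta> d1 = D_fgw \<eta> \<rho> \<beta> d1"
proof -
  have "D_fgw \<rho> \<eta> \<beta> d1 \<le> D_fgw \<eta> \<rho> \<beta> d1" for \<rho> \<eta>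
    unfolding D_fgw_def[of \<eta> \<rho>]
  proof (rule INF_greatest)
    fix \<pi> assume "\<pi> \<in> couplings \<eta> \<rho>"
    then have p: "prob_space \<pi>" "sets \<pi> = sets borel" "distr \<pi> borel fst = \<eta>" "distr \<pi> borel snd = \<rho>"
      by (auto simp: couplings_def)
    have m: "snd \<in> borel_measurable \<pi>" "fst \<in> borel_measurable \<pi>"
      unfolding measurable_cong_sets[OF p(2) refl]
      by (auto intro!: borel_measurable_continuous_onI continuous_intros)
    have "D_fgw \<rho> \<eta> \<beta> d1 \<le> fgw_cost \<beta> d1 (distr \<pi> borel (\<lambda>p. (snd p, fst p)))"
      unfolding D_fgw_def using distr_pair_in_couplings[OF p(1) m] p(3,4) by (auto intro: INF_lower)
    also have "\<dots> = fgw_cost \<beta> d1 \<pi>"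
      unfolding fgw_cost_distr[OF p(1) m d1] unfolding fgw_cost_def
      by (simp add: sym[of "snd p" "fst p" for p] power2_commute)
    finally show "D_fgw \<rho> \<eta> \<beta> d1 \<le> fgw_cost \<beta> d1 \<pi>" .
  qed
  then show ?thesis by (intro antisym)
qed

subsection \<open>Integration over directions\<close>

text \<open>Reduces equality of laws on the line to countably many equations, which turns the
  marginal constraints on a coupling into a Borel condition.\<close>

lemma measure_eqI_rat_enum:
  fixes M N :: "real measure"
  assumes M: "finite_measure M" "sets M = sets borel" and N: "sets N = sets borel"
    and eq: "\<And>n. emeasure M {rat_enum n<..} = emeasure N {rat_enum n<..}"
  shows "M = N"
proof (rule measure_eqI_lessThan[OF M(2) N])
  interpret finite_measure M by fact
  fix x :: real
  show "emeasure M {x<..} < \<infinity>" by (simp add: less_top[symmetric])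
  obtain r where r: "\<And>k. x < rat_enum (r k)" "\<And>k. rat_enum (r (Suc k)) \<le> rat_enum (r k)"
    "\<And>y. x < y \<Longrightarrow> \<exists>k. rat_enum (r k) < y"
    by (rule rat_enum_decreasing[of x]) blast
  have "x < y" if "rat_enum (r k) < y" for k y using r(1)[of k] that by simp
  then have U: "{x<..} = (\<Union>k. {rat_enum (r k)<..})" using r(3) by auto
  have "emeasure L {x<..} = (SUP k. emeasure L {rat_enum (r k)<..})" if "sets L = sets borel" for L :: "real measure"
    unfolding U
    by (rule SUP_emeasure_incseq[symmetric])
      (use r(2) that in \<open>auto intro!: incseq_SucI intro: le_less_trans\<close>)
  then show "emeasure M {x<..} = emeasure N {x<..}" using M(2) N eq by simp
qed

lemma measurable_emeasure_proj_push:
  fixes \<mu> :: "'a::euclidean_space measure"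
  assumes \<mu>: "prob_space \<mu>" "sets \<mu> = sets borel"
  shows "(\<lambda>\<theta>. emeasure (proj_push \<theta> \<mu>) {c<..}) \<in> borel_measurable borel"
proof -
  interpret prob_space \<mu> by fact
  note [measurable_cong] = \<mu>(2)
  have "emeasure (proj_push \<theta> \<mu>) {c<..} = (\<integral>\<^sup>+x. indicator {c<..} (\<theta> \<bullet> x) \<partial>\<mu>)" for \<theta>
  proof -
    have "emeasure (proj_push \<theta> \<mu>) {c<..} = (\<integral>\<^sup>+t. indicator {c<..} t \<partial>proj_push \<theta> \<mu>)"
      by (simp add: proj_push_def)
    also have "\<dots> = (\<integral>\<^sup>+x. indicator {c<..} (\<theta> \<bullet> x) \<partial>\<mu>)"
      unfolding proj_push_def by (subst nn_integral_distr) auto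
    finally show ?thesis .
  qed
  then show ?thesis by simp
qed

lemma analytic_set_D_fgw_less:
  fixes \<mu> \<nu> :: "'a::euclidean_space measure"
  assumes \<mu>: "prob_space \<mu>" "sets \<mu> = sets borel" and \<nu>: "prob_space \<nu>" "sets \<nu> = sets borel"
    and d1: "(\<lambda>p. d1 (fst p) (snd p)) \<in> borel_measurable borel"
  shows "analytic_set {\<theta>. D_fgw (proj_push \<theta> \<mu>) (proj_push \<theta> \<nu>) \<beta> d1 < c}"
proof -
  interpret U: prob_space unit_uniform by (rule prob_space_unit_uniform)
  note [measurable (raw)] = measurable_comp2_real[OF d1]
  note [measurable] = measurable_emeasure_proj_push[OF \<mu>] measurable_emeasure_proj_push[OF \<nu>]
  have [measurable]: "fst \<in> borel_measurable (borel :: (real \<times> real) measure)"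
    "snd \<in> borel_measurable (borel :: (real \<times> real) measure)"
    by (auto intro!: borel_measurable_continuous_onI continuous_intros)
  have samp [measurable (raw)]: "(\<lambda>x. pair_sampler (h x) (k x)) \<in> borel_measurable M"
    if [measurable]: "h \<in> M \<rightarrow>\<^sub>M borel" "k \<in> borel_measurable M" for M :: "'m measure" and h k
  proof -
    have "(\<lambda>x. (h x, k x)) \<in> M \<rightarrow>\<^sub>M borel \<Otimes>\<^sub>M borel" by measurable
    from measurable_compose[OF this measurable_pair_sampler] show ?thesis by simp
  qed
  define law where "law z = distr unit_uniform borel (pair_sampler z)" for z
  \<comment> \<open>Here the integrating measure is fixed and \<open>z\<close> occurs only in the
    integrand, so measurability in \<open>z\<close> follows from joint measurability of the
    sampler.\<close>
  have law_cost: "fgw_cost \<beta> d1 (law z) =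
     ennreal (1 - \<beta>) * (\<integral>\<^sup>+w. ennreal (d1 (fst (pair_sampler z w)) (snd (pair_sampler z w))) \<partial>unit_uniform)
   + ennreal \<beta> * (\<integral>\<^sup>+w. \<integral>\<^sup>+w'. ennreal ((d1 (fst (pair_sampler z w)) (fst (pair_sampler z w'))
       - d1 (snd (pair_sampler z w)) (snd (pair_sampler z w')))\<^sup>2) \<partial>unit_uniform \<partial>unit_uniform)" for z
    unfolding law_def using fgw_cost_distr[OF U.prob_space_axioms _ _ d1, of "\<lambda>w. fst (pair_sampler z w)" "\<lambda>w. snd (pair_sampler z w)"]
    by simp
  have law_fst: "emeasure (distr (law z) borel fst) {a<..} = (\<integral>\<^sup>+w. indicator {a<..} (fst (pair_sampler z w)) \<partial>unit_uniform)" for z a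
  proof -
    have "emeasure (distr (law z) borel fst) {a<..} = (\<integral>\<^sup>+t. indicator {a<..} t \<partial>distr (law z) borel fst)" by simp
    also have "\<dots> = (\<integral>\<^sup>+w. indicator {a<..} (fst (pair_sampler z w)) \<partial>unit_uniform)"
      unfolding law_def by (subst nn_integral_distr, simp, simp, subst nn_integral_distr) auto
    finally show ?thesis .
  qed
  have law_snd: "emeasure (distr (law z) borel snd) {a<..} = (\<integral>\<^sup>+w. indicator {a<..} (snd (pair_sampler z w)) \<partial>unit_uniform)" for z a
  proof -
    have "emeasure (distr (law z) borel snd) {a<..} = (\<integral>\<^sup>+t. indicator {a<..} t \<partial>distr (law z) borel snd)" by simp
    also have "\<dots> = (\<integral>\<^sup>+w. indicator {a<..} (snd (pair_sampler z w)) \<partial>unit_uniform)"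
      unfolding law_def by (subst nn_integral_distr, simp, simp, subst nn_integral_distr) auto
    finally show ?thesis .
  qed
  have law_prob: "prob_space (law z)" "sets (law z) = sets borel" for z
    unfolding law_def by (auto intro!: U.prob_space_distr)
  have law_marg: "prob_space (distr (law z) borel fst)" "prob_space (distr (law z) borel snd)" for z
    by (auto intro!: prob_space.prob_space_distr[OF law_prob(1)] simp: measurable_cong_sets[OF law_prob(2) refl])
  \<comment> \<open>The pairs of a direction and a parameter whose sampled law couples the two
    projections at cost below \<open>c\<close>. Existence of a suitable coupling thus becomes
    projection along the parameter.\<close>
  define B :: "('a \<times> (nat \<Rightarrow> nat)) set" where
    "B = {p. fgw_cost \<beta> d1 (law (snd p)) < c
        \<and> (\<forall>n. emeasure (distr (law (snd p)) borel fst) {rat_enum n<..} = emeasure (proj_push (fst p) \<mu>) {rat_enum n<..})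
        \<and> (\<forall>n. emeasure (distr (law (snd p)) borel snd) {rat_enum n<..} = emeasure (proj_push (fst p) \<nu>) {rat_enum n<..})}"
  have "{p\<in>space (borel \<Otimes>\<^sub>M borel). p \<in> B} \<in> sets (borel \<Otimes>\<^sub>M borel)"
    unfolding B_def mem_Collect_eq law_cost law_fst law_snd by measurable
  then have "B \<in> sets (borel \<Otimes>\<^sub>M borel)" by (simp add: space_pair_measure)
  then have "analytic_set B"
    unfolding borel_prod by (rule analytic_set_borel[OF metrizable_space_prod_baire])
  moreover have "{\<theta>. D_fgw (proj_push \<theta> \<mu>) (proj_push \<theta> \<nu>) \<beta> d1 < c} = fst ` B"
  proof (intro set_eqI iffI)
    fix \<theta> assume "\<theta> \<in> {\<theta>. D_fgw (proj_push \<theta> \<mu>) (proj_push \<theta> \<nu>) \<beta> d1 < c}"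
    then obtain \<pi> where \<pi>: "\<pi> \<in> couplings (proj_push \<theta> \<mu>) (proj_push \<theta> \<nu>)" "fgw_cost \<beta> d1 \<pi> < c"
      by (auto simp: D_fgw_def INF_less_iff)
    obtain z where "\<pi> = law z"
      using \<pi>(1) ex_pair_sampler_distr[of \<pi>] by (auto simp: couplings_def law_def)
    with \<pi> have "(\<theta>, z) \<in> B" by (auto simp: B_def couplings_def)
    then show "\<theta> \<in> fst ` B" by force
  next
    fix \<theta> assume "\<theta> \<in> fst ` B"
    then obtain z where z: "(\<theta>, z) \<in> B" by force
    have "distr (law z) borel fst = proj_push \<theta> \<mu>"
      using z law_marg(1)[of z]
      by (intro measure_eqI_rat_enum) (auto simp: B_def proj_push_def prob_space_def)
    moreover have "distr (law z) borel snd = proj_push \<theta> \<nu>"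
      using z law_marg(2)[of z]
      by (intro measure_eqI_rat_enum) (auto simp: B_def proj_push_def prob_space_def)
    ultimately have "law z \<in> couplings (proj_push \<theta> \<mu>) (proj_push \<theta> \<nu>)"
      using law_prob by (simp add: couplings_def)
    moreover have "fgw_cost \<beta> d1 (law z) < c" using z by (simp add: B_def)
    ultimately show "\<theta> \<in> {\<theta>. D_fgw (proj_push \<theta> \<mu>) (proj_push \<theta> \<nu>) \<beta> d1 < c}"
      unfolding D_fgw_def by (auto simp: INF_less_iff)
  qed
  ultimately show ?thesis by (simp add: analytic_set_fst_image)
qed

section \<open>The surface measure and additivity of integrals against the von Mises-Fisher
  distribution\<close>

lemma sets_sphere_measure [measurable_cong]:
  "sets (sphere_measure :: 'a::euclidean_space measure) = sets (restrict_space borel (sphere 0 1))"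
  by (simp add: sphere_measure_def)

text \<open>By the cone construction the total mass is the dimension times the volume of the
  punctured unit ball.\<close>

lemma finite_measure_sphere_measure: "finite_measure (sphere_measure :: 'a::euclidean_space measure)"
proof (rule finite_measureI)
  let ?B = "ball 0 1 - {0} :: 'a set"
  let ?D = "distr (restrict_space lborel ?B) (restrict_space borel (sphere 0 1)) (\<lambda>x. x /\<^sub>R norm x)"
  have "(\<lambda>x :: 'a. x /\<^sub>R norm x) \<in> restrict_space lborel ?B \<rightarrow>\<^sub>M restrict_space borel (sphere 0 1)"
    by (intro measurable_restrict_space2 measurable_restrict_space1) (auto simp: space_restrict_space)
  then have "emeasure ?D (space ?D) = emeasure (restrict_space lborel ?B) (space (restrict_space lborel ?B))"
    by (subst emeasure_distr)
      (auto simp: sets_restrict_space_iff dest: measurable_space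
        intro!: arg_cong[where f = "emeasure (restrict_space lborel ?B)"])
  also have "\<dots> = emeasure lborel ?B"
    by (subst emeasure_restrict_space) (auto simp: space_restrict_space)
  finally have "emeasure (sphere_measure :: 'a measure) (space sphere_measure) = of_nat DIM('a) * emeasure lborel ?B"
    by (simp add: sphere_measure_def space_scale_measure)
  also have "\<dots> \<le> of_nat DIM('a) * emeasure lborel (ball 0 1 :: 'a set)"
    by (intro mult_left_mono emeasure_mono) auto
  also have "\<dots> < \<infinity>"
    using emeasure_lborel_ball_finite[of "0 :: 'a" 1] by (simp add: ennreal_mult_less_top of_nat_less_top)
  finally show "emeasure (sphere_measure :: 'a measure) (space sphere_measure) \<noteq> \<infinity>" by simp
qed

lemma vMF_AE_borel:
  fixes g :: "'a::euclidean_space \<Rightarrow> ennreal"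
  assumes g: "\<And>c. analytic_set {\<theta>. g \<theta> < c}"
  obtains h where "h \<in> borel_measurable (vMF \<epsilon> \<kappa>)" "AE \<theta> in vMF \<epsilon> \<kappa>. g \<theta> = h \<theta>"
proof -
  let ?S = "sphere_measure :: 'a measure"
  \<comment> \<open>The surface measure lives on the sigma-algebra of the sphere. Pushing it along
    the inclusion gives a finite Borel measure on the whole space, to which the result on analytic
    sublevel sets applies; the density then carries the null set over to \<open>vMF\<close>.\<close>
  have id: "(\<lambda>x. x) \<in> ?S \<rightarrow>\<^sub>M borel"
    unfolding measurable_cong_sets[OF sets_sphere_measure refl] by (intro measurable_restrict_space1) simp
  interpret finite_measure ?S by (rule finite_measure_sphere_measure)
  obtain h where h: "h \<in> borel_measurable borel" "AE \<theta> in distr ?S borel (\<lambda>x. x). g \<theta> = h \<theta>"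
    using analytic_less_AE_borel[OF finite_measure_distr[OF id] sets_distr g] by blast
  have hm: "h \<in> borel_measurable ?S" using measurable_compose[OF id h(1)] .
  have "(\<lambda>x. exp (\<kappa> * (\<epsilon> \<bullet> x))) \<in> borel_measurable ?S"
    by (rule measurable_compose[OF id]) measurable
  then have dens: "(\<lambda>x. ennreal (vMF_const DIM('a) \<kappa> * exp (\<kappa> * (\<epsilon> \<bullet> x)))) \<in> borel_measurable ?S"
    by measurable
  have "AE \<theta> in ?S. g \<theta> = h \<theta>" using AE_distrD[OF id h(2)] .
  then have "AE \<theta> in vMF \<epsilon> \<kappa>. g \<theta> = h \<theta>"
    unfolding vMF_def AE_density[OF dens] by eventually_elim simp
  moreover have "h \<in> borel_measurable (vMF \<epsilon> \<kappa>)" using hm by (simp add: vMF_def)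
  ultimately show thesis using that by blast
qed

text \<open>The integral of an arbitrary function depends only on its values almost everywhere, so
  both functions may be replaced by measurable representatives, for which additivity holds.\<close>

lemma nn_integral_vMF_add:
  fixes f g :: "'a::euclidean_space \<Rightarrow> ennreal"
  assumes f: "\<And>c. analytic_set {\<theta>. f \<theta> < c}" and g: "\<And>c. analytic_set {\<theta>. g \<theta> < c}"
  shows "(\<integral>\<^sup>+\<theta>. K * (f \<theta> + g \<theta>) \<partial>vMF \<epsilon> \<kappa>) = K * ((\<integral>\<^sup>+\<theta>. f \<theta> \<partial>vMF \<epsilon> \<kappa>) + (\<integral>\<^sup>+\<theta>. g \<theta> \<partial>vMF \<epsilon> \<kappa>))"
proof -
  obtain f' where f' [measurable]: "f' \<in> borel_measurable (vMF \<epsilon> \<kappa>)" and ff': "AE \<theta> in vMF \<epsilon> \<kappa>. f \<theta> = f' \<theta>"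
    using vMF_AE_borel[OF f] by blast
  obtain g' where g' [measurable]: "g' \<in> borel_measurable (vMF \<epsilon> \<kappa>)" and gg': "AE \<theta> in vMF \<epsilon> \<kappa>. g \<theta> = g' \<theta>"
    using vMF_AE_borel[OF g] by blast
  have "(\<integral>\<^sup>+\<theta>. K * (f \<theta> + g \<theta>) \<partial>vMF \<epsilon> \<kappa>) = (\<integral>\<^sup>+\<theta>. K * (f' \<theta> + g' \<theta>) \<partial>vMF \<epsilon> \<kappa>)"
    using ff' gg' by (intro nn_integral_cong_AE) auto
  also have "\<dots> = K * ((\<integral>\<^sup>+\<theta>. f' \<theta> \<partial>vMF \<epsilon> \<kappa>) + (\<integral>\<^sup>+\<theta>. g' \<theta> \<partial>vMF \<epsilon> \<kappa>))"
    by (simp add: nn_integral_cmult nn_integral_add)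
  finally show ?thesis
    using nn_integral_cong_AE[OF ff'] nn_integral_cong_AE[OF gg'] by simp
qed

theorem theorem1:
  fixes \<beta> \<kappa> :: real and d1 :: "real \<Rightarrow> real \<Rightarrow> real"
  assumes "DIM('a::euclidean_space) \<ge> 2"
    and "0 \<le> \<beta>" and "\<beta> \<le> 1" and "\<kappa> > 0"
    and "pseudo_metric d1"
    and "(\<lambda>p. d1 (fst p) (snd p)) \<in> borel_measurable borel"
  shows "(\<forall>\<mu>\<in>(prob_fm :: 'a measure set). \<forall>\<nu>\<in>prob_fm. SSFG \<mu> \<nu> \<beta> \<kappa> d1 \<ge> 0)
       \<and> (\<forall>\<mu>\<in>(prob_fm :: 'a measure set). \<forall>\<nu>\<in>prob_fm. SSFG \<mu> \<nu> \<beta> \<kappa> d1 = SSFG \<nu> \<mu> \<beta> \<kappa> d1)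
       \<and> (\<exists>C'>0. \<forall>\<mu>\<in>(prob_fm :: 'a measure set). \<forall>\<nu>\<in>prob_fm. \<forall>\<xi>\<in>prob_fm.
             SSFG \<mu> \<xi> \<beta> \<kappa> d1 \<le> ennreal C' * (SSFG \<mu> \<nu> \<beta> \<kappa> d1 + SSFG \<nu> \<xi> \<beta> \<kappa> d1))"
proof -
  note d1 = assms(6)
  obtain C where nonneg: "\<And>x y. 0 \<le> d1 x y" and sym: "\<And>x y. d1 x y = d1 y x"
    and tri: "\<And>x y z. d1 x z \<le> C * (d1 x y + d1 y z)"
    using assms(5) unfolding pseudo_metric_def by blast
  \<comment> \<open>The 2 comes from the inequality for squares, \<open>C\<close> from
    \<open>d1\<close>; neither depends on the direction or the measures.\<close>
  define K where "K = max 2 C"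
  have K: "0 < K" "2 \<le> K" "C \<le> K" by (auto simp: K_def)
  have "SSFG \<mu> \<nu> \<beta> \<kappa> d1 = SSFG \<nu> \<mu> \<beta> \<kappa> d1" for \<mu> \<nu> :: "'a measure"
    unfolding SSFG_def using D_fgw_commute[OF d1 sym] by (intro SUP_cong nn_integral_cong) auto
  moreover have "SSFG \<mu> \<xi> \<beta> \<kappa> d1 \<le> ennreal K * (SSFG \<mu> \<nu> \<beta> \<kappa> d1 + SSFG \<nu> \<xi> \<beta> \<kappa> d1)"
    if "\<mu> \<in> prob_fm" "\<nu> \<in> prob_fm" "\<xi> \<in> prob_fm" for \<mu> \<nu> \<xi> :: "'a measure"
    unfolding SSFG_def[of \<mu> \<xi>]
  proof (rule SUP_least)
    fix \<epsilon> :: 'a assume \<epsilon>: "\<epsilon> \<in> sphere 0 1"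
    let ?D = "\<lambda>\<mu> \<nu> \<theta>. D_fgw (proj_push \<theta> \<mu>) (proj_push \<theta> \<nu>) \<beta> d1"
    have "(\<integral>\<^sup>+\<theta>. ?D \<mu> \<xi> \<theta> \<partial>vMF \<epsilon> \<kappa>) \<le> (\<integral>\<^sup>+\<theta>. ennreal K * (?D \<mu> \<nu> \<theta> + ?D \<nu> \<xi> \<theta>) \<partial>vMF \<epsilon> \<kappa>)"
      by (intro nn_integral_mono D_fgw_triangle[OF d1 nonneg tri K(2,3)])
    \<comment> \<open>Measurability in the direction enters here: the analytic sublevel sets allow
      the integral of the sum to be split.\<close>
    also have "\<dots> = ennreal K * ((\<integral>\<^sup>+\<theta>. ?D \<mu> \<nu> \<theta> \<partial>vMF \<epsilon> \<kappa>) + (\<integral>\<^sup>+\<theta>. ?D \<nu> \<xi> \<theta> \<partial>vMF \<epsilon> \<kappa>))"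
      using that by (intro nn_integral_vMF_add analytic_set_D_fgw_less d1) (auto simp: prob_fm_def)
    also have "\<dots> \<le> ennreal K * (SSFG \<mu> \<nu> \<beta> \<kappa> d1 + SSFG \<nu> \<xi> \<beta> \<kappa> d1)"
      unfolding SSFG_def using \<epsilon> by (intro mult_left_mono add_mono SUP_upper) auto
    finally show "(\<integral>\<^sup>+\<theta>. ?D \<mu> \<xi> \<theta> \<partial>vMF \<epsilon> \<kappa>) \<le> ennreal K * (SSFG \<mu> \<nu> \<beta> \<kappa> d1 + SSFG \<nu> \<xi> \<beta> \<kappa> d1)" .
  qed
  ultimately show ?thesis using K(1) by (intro conjI ballI exI[of _ K] zero_le) blast+
qed

end
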